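(* Let $m>1$, $D>0$, $r>0$, let $b,d$ satisfy the standing assumptions below, and assume $b'(\kappa)<0$. Then there exists a number $c_\kappa=c_\kappa(m,r,b'(\kappa),d'(\kappa))\in(0,+\infty]$ such that no semi-wavefront of the wave profile equation $$c\phi'(t)=D(\phi^m)''(t)-d(\phi(t))+b(\phi(t-cr)),\qquad t\in\mathbb R,$$ with speed $c>c_\kappa$ is eventually monotone (i.e., such semi-wavefronts must oscillate around $\kappa$, whether convergent or not). Moreover, $$c_\kappa(m,r,b'(\kappa),d'(\kappa))=\frac{\mu_\kappa(m,b'(\kappa),d'(\kappa))+o(1)}{r},\qquad r\to+\infty,$$ where $\mu_\kappa(m,b'(\kappa),d'(\kappa)):=\sqrt{\frac{2Dm\kappa^{m-1}\omega_\kappa}{b'(\kappa)}}\,e^{\frac{\omega_\kappa}{2}}$ and $\omega_\kappa<-2$ is the unique negative root of $2d'(\kappa)=b'(\kappa)e^{-\omega_\kappa}(2+\omega_\kappa)$.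
   Context: Standing assumptions: the death rate $d\in C^2([0,+\infty))$ satisfies $d(0)=0$, $d'(s)>0$ and $d''(s)\ge0$ for $s>0$. The birth rate $b\in C^1([0,+\infty);[0,+\infty))$ has exactly one positive local extremum point $s_M$, which is its global maximum point; $b(0)=0$; there is $\kappa>0$ with $b(\kappa)=d(\kappa)$; $b'(0)>d'(0)$; $b'(\kappa)<d'(\kappa)$; and $d(s)<b(s)\le b'(0)s$ for $s\in(0,\kappa)$. Moreover $s_M<\kappa$. Definition: a function $0\le\phi\in W^{1,1}_{\rm loc}(\mathbb R)\cap L^\infty(\mathbb R)$ with $\phi^m\in W^{1,1}_{\rm loc}(\mathbb R)$ is a semi-wavefront (of speed $c>0$) if (i) it satisfies the wave profile equation in the sense of distributions; (ii) $\phi(-\infty)=0$ and $0<\liminf_{t\to+\infty}\phi\le\limsup_{t\to+\infty}\phi<+\infty$; (iii) there is a maximal interval $(-\infty,t_0)$, $t_0\in(-\infty,+\infty]$, on which $\phi$ is monotonically increasing, and if $t_0<+\infty$ then $\phi(t_0)>\kappa$. Eventually monotone means monotone on some interval $[T,+\infty)$. *)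

theory Defs
  imports "HOL-Analysis.Analysis"
begin

definition test_fun :: "(real \<Rightarrow> real) \<Rightarrow> bool" where
  "test_fun \<psi> \<longleftrightarrow> (\<forall>k x. ((deriv ^^ k) \<psi>) differentiable (at x))
                     \<and> (\<exists>R. \<forall>x. R < \<bar>x\<bar> \<longrightarrow> \<psi> x = 0)"

definition loc_int :: "(real \<Rightarrow> real) \<Rightarrow> bool" where
  "loc_int f \<longleftrightarrow> (\<forall>a b. set_integrable lborel {a..b} f)"

definition W11_loc :: "(real \<Rightarrow> real) \<Rightarrow> bool" where
  "W11_loc f \<longleftrightarrow> loc_int f \<and>
     (\<exists>g. loc_int g \<and> (\<forall>\<psi>. test_fun \<psi> \<longrightarrow>
        (LINT t|lborel. f t * deriv \<psi> t) = - (LINT t|lborel. g t * \<psi> t)))"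

text \<open>Distributional form of  c phi' = D (phi^m)'' - d(phi) + b(phi(t - c r)).\<close>
definition wave_profile_distr ::
  "real \<Rightarrow> real \<Rightarrow> real \<Rightarrow> (real \<Rightarrow> real) \<Rightarrow> (real \<Rightarrow> real) \<Rightarrow> real \<Rightarrow> (real \<Rightarrow> real) \<Rightarrow> bool" where
  "wave_profile_distr D m r b d c \<phi> \<longleftrightarrow>
     (\<forall>\<psi>. test_fun \<psi> \<longrightarrow>
        (LINT t|lborel. c * \<phi> t * deriv \<psi> t + D * (\<phi> t powr m) * deriv (deriv \<psi>) t
                        - d (\<phi> t) * \<psi> t + b (\<phi> (t - c * r)) * \<psi> t) = 0)"

text \<open>Semi-wavefront of speed c (phi identified with its continuous representative).\<close>
definition semi_wavefront ::
  "real \<Rightarrow> real \<Rightarrow> real \<Rightarrow> real \<Rightarrow> (real \<Rightarrow> real) \<Rightarrow> (real \<Rightarrow> real) \<Rightarrow> real \<Rightarrow> (real \<Rightarrow> real) \<Rightarrow> bool" where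
  "semi_wavefront D m r \<kappa> b d c \<phi> \<longleftrightarrow>
     0 < c \<and> (\<forall>t. 0 \<le> \<phi> t) \<and> continuous_on UNIV \<phi> \<and> bounded (range \<phi>) \<and>
     W11_loc \<phi> \<and> W11_loc (\<lambda>t. \<phi> t powr m) \<and>
     wave_profile_distr D m r b d c \<phi> \<and>
     (\<phi> \<longlongrightarrow> 0) at_bot \<and>
     0 < Liminf at_top (\<lambda>t. ereal (\<phi> t)) \<and>
     Liminf at_top (\<lambda>t. ereal (\<phi> t)) \<le> Limsup at_top (\<lambda>t. ereal (\<phi> t)) \<and>
     Limsup at_top (\<lambda>t. ereal (\<phi> t)) < \<infinity> \<and>
     (\<exists>t0::ereal. -\<infinity> < t0 \<and> mono_on {t. ereal t < t0} \<phi> \<and>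
        (\<forall>t1. t0 < t1 \<longrightarrow> \<not> mono_on {t. ereal t < t1} \<phi>) \<and>
        (t0 < \<infinity> \<longrightarrow> \<kappa> < \<phi> (real_of_ereal t0)))"

definition eventually_monotone :: "(real \<Rightarrow> real) \<Rightarrow> bool" where
  "eventually_monotone \<phi> \<longleftrightarrow>
     (\<exists>T. (\<forall>x y. T \<le> x \<longrightarrow> x \<le> y \<longrightarrow> \<phi> x \<le> \<phi> y) \<or>
          (\<forall>x y. T \<le> x \<longrightarrow> x \<le> y \<longrightarrow> \<phi> y \<le> \<phi> x))"

definition loc_ext_pt :: "(real \<Rightarrow> real) \<Rightarrow> real \<Rightarrow> bool" where
  "loc_ext_pt f s \<longleftrightarrow> (\<exists>e>0. (\<forall>y. 0 \<le> y \<and> \<bar>y - s\<bar> < e \<longrightarrow> f y \<le> f s) \<or>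
                              (\<forall>y. 0 \<le> y \<and> \<bar>y - s\<bar> < e \<longrightarrow> f s \<le> f y))"

definition standing_assms ::
  "real \<Rightarrow> (real \<Rightarrow> real) \<Rightarrow> (real \<Rightarrow> real) \<Rightarrow> (real \<Rightarrow> real) \<Rightarrow> (real \<Rightarrow> real) \<Rightarrow> (real \<Rightarrow> real) \<Rightarrow> bool" where
  "standing_assms \<kappa> b b' d d' d'' \<longleftrightarrow>
     (\<forall>s\<ge>0. (d has_real_derivative d' s) (at s within {0..}) \<and>
             (d' has_real_derivative d'' s) (at s within {0..})) \<and>
     continuous_on {0..} d'' \<and>
     d 0 = 0 \<and> (\<forall>s>0. 0 < d' s \<and> 0 \<le> d'' s) \<and>
     (\<forall>s\<ge>0. (b has_real_derivative b' s) (at s within {0..}) \<and> 0 \<le> b s) \<and>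
     continuous_on {0..} b' \<and>
     (\<exists>sM>0. {s. 0 < s \<and> loc_ext_pt b s} = {sM} \<and> (\<forall>s\<ge>0. b s \<le> b sM) \<and> sM < \<kappa>) \<and>
     b 0 = 0 \<and> 0 < \<kappa> \<and> b \<kappa> = d \<kappa> \<and> d' 0 < b' 0 \<and> b' \<kappa> < d' \<kappa> \<and>
     (\<forall>s. 0 < s \<and> s < \<kappa> \<longrightarrow> d s < b s \<and> b s \<le> b' 0 * s)"

definition omega_k :: "real \<Rightarrow> real \<Rightarrow> real" where
  "omega_k \<beta> \<delta> = (THE \<omega>. \<omega> < 0 \<and> 2 * \<delta> = \<beta> * exp (- \<omega>) * (2 + \<omega>))"

definition mu_k :: "real \<Rightarrow> real \<Rightarrow> real \<Rightarrow> real \<Rightarrow> real \<Rightarrow> real" where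
  "mu_k D m \<kappa> \<beta> \<delta> =
     sqrt (2 * D * m * \<kappa> powr (m - 1) * omega_k \<beta> \<delta> / \<beta>) * exp (omega_k \<beta> \<delta> / 2)"

end

theory Submission
  imports Defs
begin

text \<open>
  An eventually monotone semi-wavefront converges to \<^term>\<open>\<kappa>\<close>. The weak equation, tested against
  mollified second differences, makes \<^term>\<open>\<phi>\<close> a classical solution, and the distance of
  \<^term>\<open>\<phi>\<close> to \<^term>\<open>\<kappa>\<close> is then asymptotically a positive decreasing solution of
  \<open>A v'' - c v' = \<delta> v + \<bar>\<beta>\<bar> v(t - cr)\<close>, where \<open>A = D m \<kappa>\<^bsup>m-1\<^esup>\<close>, \<open>\<delta> = d'(\<kappa>)\<close> and
  \<open>\<beta> = b'(\<kappa>)\<close>. If \<open>v\<close> decays at rate at least \<open>x\<close>, the delayed term forces the larger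
  rate \<open>y\<close> with \<open>A y\<^sup>2 + c y = \<delta> + \<bar>\<beta>\<bar> e\<^bsup>xcr\<^esup>\<close>. When \<open>A x\<^sup>2 + c x\<close> stays below the right-hand
  side for all \<open>x \<ge> 0\<close> with a relative margin, iteration gives arbitrarily fast exponential decay,
  whereas the delayed term also bounds \<open>v(t)\<close> below by a fixed multiple of \<open>v(t - cr/4)\<close>.

  In the variable \<open>\<omega> = - x c r\<close> the parabola \<open>A \<omega>\<^sup>2 / \<mu>\<^sup>2\<close> touches \<open>\<delta> + \<bar>\<beta>\<bar> e\<^bsup>-\<omega>\<^esup>\<close> exactly for
  \<open>\<mu> = \<mu>\<^sub>\<kappa>\<close> at \<open>\<omega>\<^sub>\<kappa>\<close>, and \<open>c x \<le> e\<^bsup>xcr\<^esup> / r\<close> is a perturbation of relative size at most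
  \<open>1 / (r \<bar>\<beta>\<bar>)\<close>. Hence the speeds \<open>c\<close> with \<open>(c r)\<^sup>2 > \<mu>\<^sub>\<kappa>\<^sup>2 / (1 - 1 / (r \<bar>\<beta>\<bar>))\<close> have the margin.
\<close>

section \<open>Smooth functions and test functions\<close>

definition smooth_fun :: "(real \<Rightarrow> real) \<Rightarrow> bool" where
  "smooth_fun f \<longleftrightarrow> (\<forall>k x. ((deriv ^^ k) f) differentiable (at x))"

text \<open>If every member of a class has a derivative that again lies in the class, all iterated
  derivatives stay there. Smoothness thus follows without a formula for higher derivatives.\<close>

lemma smooth_fun_coinduct:
  assumes "S f"
    and step: "\<And>f. S f \<Longrightarrow> \<exists>g. S g \<and> (\<forall>x. (f has_real_derivative g x) (at x))"
  shows "smooth_fun f"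
proof -
  have "S ((deriv ^^ k) f)" for k
  proof (induction k)
    case (Suc k)
    obtain g where g: "S g" "\<And>x. ((deriv ^^ k) f has_real_derivative g x) (at x)"
      using step[OF Suc] by blast
    have "deriv ((deriv ^^ k) f) = g"
      using g(2) by (intro ext DERIV_imp_deriv)
    then show ?case using g(1) by simp
  qed (simp add: assms(1))
  then show ?thesis
    unfolding smooth_fun_def using step real_differentiable_def by blast
qed

lemma smooth_fun_deriv:
  assumes "smooth_fun f"
  shows "smooth_fun (deriv f)" and "(f has_real_derivative deriv f x) (at x)"
proof -
  show "smooth_fun (deriv f)"
    unfolding smooth_fun_def
  proof (intro allI)
    fix k x
    show "(deriv ^^ k) (deriv f) differentiable at x"
      using assms[unfolded smooth_fun_def, rule_format, of "Suc k" x]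
      by (simp only: funpow_Suc_right comp_def)
  qed
  have "f differentiable (at x)"
    using assms unfolding smooth_fun_def by (metis funpow_0)
  then show "(f has_real_derivative deriv f x) (at x)"
    using DERIV_deriv_iff_real_differentiable by blast
qed

lemma smooth_fun_antiderivative:
  assumes "\<And>x. (f has_real_derivative g x) (at x)" and "smooth_fun g"
  shows "smooth_fun f"
proof (rule smooth_fun_coinduct[where S = "\<lambda>h. h = f \<or> smooth_fun h"])
  fix h assume "h = f \<or> smooth_fun h"
  then show "\<exists>g. (g = f \<or> smooth_fun g) \<and> (\<forall>x. (h has_real_derivative g x) (at x))"
    using assms smooth_fun_deriv by metis
qed simp

lemma smooth_fun_add:
  assumes "smooth_fun f" "smooth_fun g"
  shows "smooth_fun (\<lambda>x. f x + g x)"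
proof (rule smooth_fun_coinduct
    [where S = "\<lambda>h. \<exists>f g. smooth_fun f \<and> smooth_fun g \<and> h = (\<lambda>x. f x + g x)"])
  fix h :: "real \<Rightarrow> real"
  assume "\<exists>f g. smooth_fun f \<and> smooth_fun g \<and> h = (\<lambda>x. f x + g x)"
  then obtain f g where fg: "smooth_fun f" "smooth_fun g" "h = (\<lambda>x. f x + g x)" by blast
  show "\<exists>k. (\<exists>f g. smooth_fun f \<and> smooth_fun g \<and> k = (\<lambda>x. f x + g x))
      \<and> (\<forall>x. (h has_real_derivative k x) (at x))"
    unfolding fg(3)
    by (rule exI[of _ "\<lambda>x. deriv f x + deriv g x"])
       (use fg smooth_fun_deriv in \<open>auto intro!: derivative_intros\<close>)
qed (use assms in blast)

lemma smooth_fun_affine: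
  assumes "smooth_fun f"
  shows "smooth_fun (\<lambda>x. k * f (p * x + q))"
proof (rule smooth_fun_coinduct
    [where S = "\<lambda>h. \<exists>f k. smooth_fun f \<and> h = (\<lambda>x. k * f (p * x + q))"])
  fix h :: "real \<Rightarrow> real"
  assume "\<exists>f k. smooth_fun f \<and> h = (\<lambda>x. k * f (p * x + q))"
  then obtain f k where fk: "smooth_fun f" "h = (\<lambda>x. k * f (p * x + q))" by blast
  have "(h has_real_derivative (k * p) * deriv f (p * x + q)) (at x)" for x
    unfolding fk(2)
    by (rule derivative_eq_intros DERIV_chain2[OF smooth_fun_deriv(2)[OF fk(1)]] refl | simp)+
  then show "\<exists>g. (\<exists>f k. smooth_fun f \<and> g = (\<lambda>x. k * f (p * x + q)))
      \<and> (\<forall>x. (h has_real_derivative g x) (at x))"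
    using smooth_fun_deriv(1)[OF fk(1)] by blast
qed (use assms in blast)

lemma continuous_on_UNIV_if_DERIV:
  assumes "\<And>x. (f has_real_derivative g x) (at x)"
  shows "continuous_on UNIV f"
  using assms by (auto intro!: DERIV_isCont simp: continuous_on_eq_continuous_at)

section \<open>Smooth functions vanishing on a half-line\<close>

definition flat :: "real poly \<Rightarrow> real \<Rightarrow> real" where
  "flat p x = (if 0 < x then poly p (inverse x) * exp (- inverse x) else 0)"

text \<open>The power \<open>y ^ k\<close> is there for the induction: peeling off a coefficient of
  \<open>p\<close> moves one factor \<open>y\<close> from the polynomial into the power.\<close>

lemma tendsto_poly_div_exp_0:
  "((\<lambda>y::real. y ^ k * poly p y / exp y) \<longlongrightarrow> 0) at_top"
proof (induction p arbitrary: k)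
  case (pCons a p)
  have "((\<lambda>y. a * (y ^ k / exp y) + y ^ Suc k * poly p y / exp y) \<longlongrightarrow> a * 0 + 0) at_top"
    by (intro tendsto_intros tendsto_power_div_exp_0 pCons.IH)
  moreover have "(\<lambda>y. a * (y ^ k / exp y) + y ^ Suc k * poly p y / exp y)
      = (\<lambda>y. y ^ k * poly (pCons a p) y / exp y)"
    by (auto simp: field_simps)
  ultimately show ?case by simp
qed simp

text \<open>With \<open>y = 1 / x\<close>, the chain rule turns \<open>p(y) exp(-y)\<close> into
  \<open>y^2 (p(y) - p'(y)) exp(-y)\<close>, so the polynomial factor keeps the family closed under
  differentiation. At the origin the right difference quotient is \<open>y p(y) / exp y\<close>,
  which tends to 0.\<close>

lemma flat_has_derivative:
  "(flat p has_real_derivative flat (monom 1 2 * (p - pderiv p)) x) (at x)"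
proof -
  consider "x < 0" | "x = 0" | "0 < x" by linarith
  then show ?thesis
  proof cases
    case 1
    have "((\<lambda>_. 0) has_real_derivative flat (monom 1 2 * (p - pderiv p)) x) (at x)"
      using 1 by (simp add: flat_def)
    then show ?thesis
      by (rule has_field_derivative_transform_within_open[where S = "{..<0}"])
         (use 1 in \<open>auto simp: flat_def\<close>)
  next
    case 2
    have "((\<lambda>h. inverse h ^ 1 * poly p (inverse h) / exp (inverse h)) \<longlongrightarrow> 0) (at_right 0)"
      by (rule filterlim_compose[OF tendsto_poly_div_exp_0 filterlim_inverse_at_top_right])
    then have right: "((\<lambda>h. flat p h / h) \<longlongrightarrow> 0) (at_right 0)"
      by (rule Lim_transform_eventually)
         (auto simp: flat_def eventually_at_filter exp_minus field_simps)
    have "((\<lambda>_. 0) \<longlongrightarrow> 0) (at_left (0::real))" by simp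
    then have left: "((\<lambda>h. flat p h / h) \<longlongrightarrow> 0) (at_left 0)"
      by (rule Lim_transform_eventually) (auto simp: flat_def eventually_at_filter)
    show ?thesis
      using left right 2 by (simp add: DERIV_def filterlim_split_at flat_def)
  next
    case 3
    have "((\<lambda>x. poly p (inverse x) * exp (- inverse x)) has_real_derivative
        flat (monom 1 2 * (p - pderiv p)) x) (at x)"
      using 3
      by (auto intro!: derivative_eq_intros DERIV_chain2[OF poly_DERIV]
          simp: flat_def poly_monom algebra_simps power2_eq_square)
    then show ?thesis
      by (rule has_field_derivative_transform_within_open[where S = "{0<..}"])
         (use 3 in \<open>auto simp: flat_def\<close>)
  qed
qed

text \<open>The generators vanish outside \<open>(-1, 1)\<close>; sums enter because the product
  rule produces two of them. The span is closed under differentiation, as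
  \<open>smooth_fun_coinduct\<close> requires.\<close>

inductive flat_product_span :: "(real \<Rightarrow> real) \<Rightarrow> bool" where
  base: "flat_product_span (\<lambda>x. k * (flat p (1 + x) * flat q (1 - x)))"
| add: "flat_product_span f \<Longrightarrow> flat_product_span g \<Longrightarrow> flat_product_span (\<lambda>x. f x + g x)"

lemma flat_product_span_derivative:
  assumes "flat_product_span f"
  shows "\<exists>g. flat_product_span g \<and> (\<forall>x. (f has_real_derivative g x) (at x))"
  using assms
proof induction
  case (base k p q)
  define s where "s p = monom 1 2 * (p - pderiv p)" for p :: "real poly"
  let ?g = "\<lambda>x. k * (flat (s p) (1 + x) * flat q (1 - x))
      + (- k) * (flat p (1 + x) * flat (s q) (1 - x))"
  have "((\<lambda>x. k * (flat p (1 + x) * flat q (1 - x))) has_real_derivative ?g x) (at x)" for x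
    unfolding s_def
    by (rule derivative_eq_intros DERIV_chain2[OF flat_has_derivative] refl
        | simp add: algebra_simps)+
  then show ?case
    using flat_product_span.intros by (intro exI[of _ ?g]) blast
next
  case (add f g)
  then obtain f' g' where "flat_product_span f'" "\<And>x. (f has_real_derivative f' x) (at x)"
    "flat_product_span g'" "\<And>x. (g has_real_derivative g' x) (at x)" by blast
  then show ?case
    by (intro exI[of _ "\<lambda>x. f' x + g' x"])
       (auto intro: flat_product_span.add derivative_intros)
qed

section \<open>Mollifiers and their iterated antiderivatives\<close>

lemma DERIV_zero_imp_eq:
  fixes f :: "real \<Rightarrow> real"
  assumes "a \<le> b" and "\<And>x. \<lbrakk>a \<le> x; x \<le> b\<rbrakk> \<Longrightarrow> (f has_real_derivative 0) (at x)"
  shows "f a = f b"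
proof (cases "a = b")
  case False
  then show ?thesis
    using assms DERIV_isconst_end[of a b f]
    by (metis DERIV_atLeastAtMost_imp_continuous_on less_eq_real_def)
qed simp

lemma continuous_antiderivative_exists:
  fixes f :: "real \<Rightarrow> real"
  assumes "continuous_on UNIV f"
  obtains F where "\<And>x. (F has_real_derivative f x) (at x)"
proof -
  have "\<exists>F. \<forall>x. -\<infinity> < ereal x \<longrightarrow> ereal x < \<infinity> \<longrightarrow> (F has_vector_derivative f x) (at x)"
    by (rule einterval_antiderivative) (use assms in \<open>auto simp: continuous_on_eq_continuous_at\<close>)
  then show ?thesis
    using that by (auto simp: has_real_derivative_iff_has_vector_derivative)
qed

text \<open>\<open>\<rho>\<close> is a mollifier, \<open>R1\<close> a smoothed Heaviside function
  and \<open>R\<close> a smoothed positive part up to the offset \<open>k\<close>. That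
  \<open>\<rho>\<close> has mass 1 is encoded in the values of \<open>R1\<close> on either side of
  its support.\<close>

definition smooth_ramp ::
  "(real \<Rightarrow> real) \<Rightarrow> (real \<Rightarrow> real) \<Rightarrow> (real \<Rightarrow> real) \<Rightarrow> real \<Rightarrow> bool" where
  "smooth_ramp R R1 \<rho> k \<longleftrightarrow> smooth_fun R \<and>
    (\<forall>x. (R has_real_derivative R1 x) (at x)) \<and> (\<forall>x. (R1 has_real_derivative \<rho> x) (at x)) \<and>
    continuous_on UNIV \<rho> \<and> (\<forall>x. 0 \<le> \<rho> x) \<and> (\<forall>x. 1 \<le> \<bar>x\<bar> \<longrightarrow> \<rho> x = 0) \<and>
    (\<forall>x\<le>-1. R x = 0 \<and> R1 x = 0) \<and> (\<forall>x\<ge>1. R x = x + k \<and> R1 x = 1)"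

lemma smooth_ramp_exists: "\<exists>R R1 \<rho> k. smooth_ramp R R1 \<rho> k"
proof -
  define u where "u = (\<lambda>x. 1 * (flat 1 (1 + x) * flat 1 (1 - x)))"
  have su: "flat_product_span u" unfolding u_def by (rule flat_product_span.base)
  have smu: "smooth_fun u"
    using su flat_product_span_derivative by (rule smooth_fun_coinduct[where S = flat_product_span])
  have u_nonneg: "0 \<le> u x" for x by (auto simp: u_def flat_def)
  have u_pos: "0 < u x" if "-1 < x" "x < 1" for x using that by (auto simp: u_def flat_def)
  have u_zero: "u x = 0" if "1 \<le> \<bar>x\<bar>" for x
    using that by (auto simp: u_def flat_def abs_if split: if_splits)
  have contu: "continuous_on UNIV u"
    by (rule continuous_on_UNIV_if_DERIV[OF smooth_fun_deriv(2)[OF smu]])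
  obtain F where F: "\<And>x. (F has_real_derivative u x) (at x)"
    using continuous_antiderivative_exists[OF contu] by blast
  \<comment> \<open>Total mass of the bump; dividing by it makes \<open>R1\<close> equal to 1 to the
    right of the support.\<close>
  define I where "I = F 1 - F (-1)"
  have "F (-1) < F 1"
  proof (rule DERIV_pos_imp_increasing_open[where f = F])
    show "continuous_on {-1..1} F"
      using continuous_on_subset[OF continuous_on_UNIV_if_DERIV[OF F]] by simp
  qed (use F u_pos in auto)
  then have I: "0 < I" by (simp add: I_def)
  define \<rho> where "\<rho> x = u x / I" for x
  define R1 where "R1 x = (F x - F (-1)) / I" for x
  have R1: "(R1 has_real_derivative \<rho> x) (at x)" for x
    unfolding R1_def \<rho>_def using I by (auto intro!: derivative_eq_intros F)
  have R1_left: "R1 x = 0" if "x \<le> -1" for x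
  proof -
    have "R1 x = R1 (-1)"
      by (rule DERIV_zero_imp_eq[OF that]) (rule DERIV_cong[OF R1], simp add: \<rho>_def u_zero)
    then show ?thesis by (simp add: R1_def)
  qed
  have R1_right: "R1 x = 1" if "1 \<le> x" for x
  proof -
    have "R1 1 = R1 x"
      by (rule DERIV_zero_imp_eq[OF that]) (rule DERIV_cong[OF R1], simp add: \<rho>_def u_zero)
    then show ?thesis using I by (simp add: R1_def I_def)
  qed
  have "continuous_on UNIV R1" by (rule continuous_on_UNIV_if_DERIV[OF R1])
  then obtain G where G: "\<And>x. (G has_real_derivative R1 x) (at x)"
    using continuous_antiderivative_exists by blast
  define R where "R x = G x - G (-1)" for x
  have R: "(R has_real_derivative R1 x) (at x)" for x
    unfolding R_def by (auto intro!: derivative_eq_intros G)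
  have R_left: "R x = 0" if "x \<le> -1" for x
  proof -
    have "R x = R (-1)"
      by (rule DERIV_zero_imp_eq[OF that]) (rule DERIV_cong[OF R], simp add: R1_left)
    then show ?thesis by (simp add: R_def)
  qed
  have R_right: "R x = x + (R 1 - 1)" if "1 \<le> x" for x
  proof -
    have "R 1 - 1 = R x - x"
      by (rule DERIV_zero_imp_eq[OF that])
         (auto intro!: derivative_eq_intros R simp: R1_right)
    then show ?thesis by simp
  qed
  have "\<rho> = (\<lambda>x. inverse I * u (1 * x + 0))" by (auto simp: \<rho>_def field_simps)
  then have "smooth_fun \<rho>" by (simp only: smooth_fun_affine[OF smu])
  then have "smooth_fun R"
    by (intro smooth_fun_antiderivative[OF R] smooth_fun_antiderivative[OF R1])
  moreover have "continuous_on UNIV \<rho>"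
    unfolding \<rho>_def by (intro continuous_intros contu) (use I in auto)
  moreover have "0 \<le> \<rho> x" "1 \<le> \<bar>x\<bar> \<Longrightarrow> \<rho> x = 0" for x
    using u_nonneg u_zero I by (auto simp: \<rho>_def)
  ultimately have "smooth_ramp R R1 \<rho> (R 1 - 1)"
    unfolding smooth_ramp_def using R R1 R_left R_right R1_left R1_right by blast
  then show ?thesis by blast
qed

text \<open>The weight has mass 1 and lives within distance \<open>\<epsilon>\<close> of
  \<open>a\<close>, so the difference averages \<open>E y - E a\<close> over points where continuity
  makes it small. The condition on \<open>N\<close> keeps the support inside the window.\<close>

lemma mollifier_integral_close:
  fixes E :: "real \<Rightarrow> real"
  assumes contE: "continuous_on UNIV E"
    and ramp: "smooth_ramp R R1 \<rho> k"
    and "0 < \<eta>"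
  shows "\<exists>\<epsilon>0>0. \<forall>\<epsilon> N. 0 < \<epsilon> \<and> \<epsilon> \<le> \<epsilon>0 \<and> \<bar>a\<bar> + \<epsilon> \<le> N \<longrightarrow>
    \<bar>integral {-N..N} (\<lambda>y. E y * (\<rho> ((y - a) / \<epsilon>) / \<epsilon>)) - E a\<bar> \<le> \<eta>"
proof -
  have R1: "\<And>x. (R1 has_real_derivative \<rho> x) (at x)" and cont\<rho>: "continuous_on UNIV \<rho>"
    and nonneg: "\<And>x. 0 \<le> \<rho> x" and supp: "\<And>x. 1 \<le> \<bar>x\<bar> \<Longrightarrow> \<rho> x = 0"
    and left: "\<And>x. x \<le> -1 \<Longrightarrow> R1 x = 0"
    and right: "\<And>x. 1 \<le> x \<Longrightarrow> R1 x = 1"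
    using ramp unfolding smooth_ramp_def by blast+
  have "isCont E a" using contE by (simp add: continuous_on_eq_continuous_at)
  then obtain \<epsilon>0 where \<epsilon>0: "0 < \<epsilon>0" "\<And>y. \<bar>y - a\<bar> < \<epsilon>0 \<Longrightarrow> \<bar>E y - E a\<bar> < \<eta>"
    using \<open>0 < \<eta>\<close> unfolding continuous_at_eps_delta dist_real_def by metis
  have "\<bar>integral {-N..N} (\<lambda>y. E y * (\<rho> ((y - a) / \<epsilon>) / \<epsilon>)) - E a\<bar> \<le> \<eta>"
    if \<epsilon>: "0 < \<epsilon>" "\<epsilon> \<le> \<epsilon>0" and N: "\<bar>a\<bar> + \<epsilon> \<le> N" for \<epsilon> N
  proof -
    let ?w = "\<lambda>y. \<rho> ((y - a) / \<epsilon>) / \<epsilon>"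
    have "(?w has_integral R1 ((N - a) / \<epsilon>) - R1 ((- N - a) / \<epsilon>)) {-N..N}"
    proof (rule fundamental_theorem_of_calculus)
      show "((\<lambda>y. R1 ((y - a) / \<epsilon>)) has_vector_derivative ?w y) (at y within {-N..N})" for y
        unfolding has_real_derivative_iff_has_vector_derivative[symmetric]
      proof (rule has_field_derivative_at_within)
        have "((\<lambda>y. (y - a) / \<epsilon>) has_real_derivative 1 / \<epsilon>) (at y)"
          using \<epsilon> by (auto intro!: derivative_eq_intros)
        then show "((\<lambda>y. R1 ((y - a) / \<epsilon>)) has_real_derivative ?w y) (at y)"
          using DERIV_chain2[OF R1] by fastforce
      qed
    qed (use N \<epsilon> in linarith)
    moreover have "R1 ((N - a) / \<epsilon>) = 1" "R1 ((- N - a) / \<epsilon>) = 0"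
      by (rule right left; use N \<epsilon> in \<open>simp add: field_simps abs_le_iff\<close>)+
    ultimately have w: "(?w has_integral 1) {-N..N}" by simp
    have contw: "continuous_on UNIV ?w"
      using \<epsilon> by (intro continuous_intros continuous_on_compose2[OF cont\<rho>]) auto
    have intE: "(\<lambda>y. E y * ?w y) integrable_on {-N..N}" "(\<lambda>y. (E y - E a) * ?w y) integrable_on {-N..N}"
      by (intro integrable_continuous_interval continuous_intros
          continuous_on_subset[OF contE] continuous_on_subset[OF contw]; simp)+
    have "norm (integral {-N..N} (\<lambda>y. (E y - E a) * ?w y)) \<le> integral {-N..N} (\<lambda>y. \<eta> * ?w y)"
    proof (rule integral_norm_bound_integral[OF intE(2)])
      show "(\<lambda>y. \<eta> * ?w y) integrable_on {-N..N}"
        using w by (intro integrable_on_mult_right) blast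
      show "norm ((E y - E a) * ?w y) \<le> \<eta> * ?w y" for y
      proof (cases "\<bar>y - a\<bar> < \<epsilon>")
        case True
        then have "\<bar>E y - E a\<bar> \<le> \<eta>" using \<epsilon>0(2)[of y] \<epsilon> by linarith
        then show ?thesis
          using nonneg \<epsilon> by (simp add: abs_mult mult_right_mono divide_right_mono)
      next
        case False
        then have "\<rho> ((y - a) / \<epsilon>) = 0"
          using \<epsilon> by (intro supp) (simp add: field_simps)
        then show ?thesis by simp
      qed
    qed
    also have "\<dots> = \<eta>" using integral_unique[OF has_integral_mult_right[OF w, of \<eta>]] by (simp only: mult_1_right)
    also have "integral {-N..N} (\<lambda>y. (E y - E a) * ?w y) = integral {-N..N} (\<lambda>y. E y * ?w y) - E a"
    proof -
      have "((\<lambda>y. E y * ?w y - E a * ?w y) has_integral integral {-N..N} (\<lambda>y. E y * ?w y) - E a * 1) {-N..N}"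
        by (intro has_integral_diff integrable_integral intE has_integral_mult_right w)
      from integral_unique[OF this] show ?thesis by (simp only: left_diff_distrib mult_1_right)
    qed
    finally show ?thesis by simp
  qed
  then show ?thesis using \<epsilon>0(1) by blast
qed

text \<open>Three mollifiers at \<open>0\<close>, \<open>1\<close> and \<open>x\<close> with
  coefficients \<open>1 - x\<close>, \<open>x\<close> and \<open>-1\<close> form the second
  derivative of an admissible \<open>\<psi>\<close>: the coefficients annihilate affine functions,
  so the matching combination of ramps vanishes on the far right as well as on the far left. As the
  mollifiers shrink, the vanishing integral becomes the claimed three-point identity.\<close>

lemma affine_if_annihilates_second_derivatives:
  fixes E :: "real \<Rightarrow> real"
  assumes contE: "continuous_on UNIV E"
    and ann: "\<And>\<psi> N. 0 < N \<Longrightarrow> smooth_fun \<psi> \<Longrightarrow> (\<And>x. N - 1 \<le> \<bar>x\<bar> \<Longrightarrow> \<psi> x = 0) \<Longrightarrow>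
      integral {-N..N} (\<lambda>x. E x * deriv (deriv \<psi>) x) = 0"
  shows "E x = (1 - x) * E 0 + x * E 1"
proof -
  obtain R R1 \<rho> k where ramp: "smooth_ramp R R1 \<rho> k"
    using smooth_ramp_exists by blast
  have smR: "smooth_fun R" and R: "\<And>x. (R has_real_derivative R1 x) (at x)"
    and R1: "\<And>x. (R1 has_real_derivative \<rho> x) (at x)" and cont\<rho>: "continuous_on UNIV \<rho>"
    and Rleft: "\<And>x. x \<le> -1 \<Longrightarrow> R x = 0"
    and Rright: "\<And>x. 1 \<le> x \<Longrightarrow> R x = x + k"
    using ramp unfolding smooth_ramp_def by blast+
  have "\<bar>(1 - x) * E 0 + x * E 1 - E x\<bar> \<le> (\<bar>1 - x\<bar> + \<bar>x\<bar> + 1) * \<eta>" if "0 < \<eta>" for \<eta>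
  proof -
    have mol: "\<exists>\<epsilon>0>0. \<forall>\<epsilon> N. 0 < \<epsilon> \<and> \<epsilon> \<le> \<epsilon>0 \<and> \<bar>a\<bar> + \<epsilon> \<le> N \<longrightarrow>
        \<bar>integral {-N..N} (\<lambda>y. E y * (\<rho> ((y - a) / \<epsilon>) / \<epsilon>)) - E a\<bar> \<le> \<eta>" for a
      by (rule mollifier_integral_close[OF contE ramp that])
    obtain e0 where e0: "0 < e0" and close0: "\<And>\<epsilon> N. \<lbrakk>0 < \<epsilon>; \<epsilon> \<le> e0; \<bar>0\<bar> + \<epsilon> \<le> N\<rbrakk> \<Longrightarrow>
        \<bar>integral {-N..N} (\<lambda>y. E y * (\<rho> ((y - 0) / \<epsilon>) / \<epsilon>)) - E 0\<bar> \<le> \<eta>"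
      using mol[of 0] by blast
    obtain e1 where e1: "0 < e1" and close1: "\<And>\<epsilon> N. \<lbrakk>0 < \<epsilon>; \<epsilon> \<le> e1; \<bar>1\<bar> + \<epsilon> \<le> N\<rbrakk> \<Longrightarrow>
        \<bar>integral {-N..N} (\<lambda>y. E y * (\<rho> ((y - 1) / \<epsilon>) / \<epsilon>)) - E 1\<bar> \<le> \<eta>"
      using mol[of 1] by blast
    obtain ex where ex: "0 < ex" and closex: "\<And>\<epsilon> N. \<lbrakk>0 < \<epsilon>; \<epsilon> \<le> ex; \<bar>x\<bar> + \<epsilon> \<le> N\<rbrakk> \<Longrightarrow>
        \<bar>integral {-N..N} (\<lambda>y. E y * (\<rho> ((y - x) / \<epsilon>) / \<epsilon>)) - E x\<bar> \<le> \<eta>"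
      using mol[of x] by blast
    define \<epsilon> where "\<epsilon> = min e0 (min e1 ex)"
    have \<epsilon>: "0 < \<epsilon>" "\<epsilon> \<le> e0" "\<epsilon> \<le> e1" "\<epsilon> \<le> ex" using e0 e1 ex by (auto simp: \<epsilon>_def)
    define N where "N = 2 + \<bar>x\<bar> + \<epsilon>"
    define w where "w a y = \<rho> ((y - a) / \<epsilon>) / \<epsilon>" for a y
    define I where "I a = integral {-N..N} (\<lambda>y. E y * w a y)" for a
    have I: "\<bar>I 0 - E 0\<bar> \<le> \<eta>" "\<bar>I 1 - E 1\<bar> \<le> \<eta>" "\<bar>I x - E x\<bar> \<le> \<eta>"
      unfolding I_def w_def by (rule close0 close1 closex; use \<epsilon> in \<open>simp add: N_def\<close>)+
    \<comment> \<open>The factor \<open>\<epsilon>\<close> compensates for the scaling: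
      \<open>\<epsilon> * R ((y - a) / \<epsilon>)\<close> has second derivative
      \<open>w a y\<close>. The spelling matches \<open>smooth_fun_affine\<close>.\<close>
    define \<psi> where "\<psi> y = ((1 - x) * \<epsilon>) * R (1 / \<epsilon> * y + (- 0 / \<epsilon>))
        + ((x * \<epsilon>) * R (1 / \<epsilon> * y + (- 1 / \<epsilon>)) + (- \<epsilon>) * R (1 / \<epsilon> * y + (- x / \<epsilon>)))" for y
    have "smooth_fun \<psi>"
      unfolding \<psi>_def by (intro smooth_fun_add smooth_fun_affine smR)
    moreover have "\<psi> y = 0" if y: "N - 1 \<le> \<bar>y\<bar>" for y
    proof (cases "0 \<le> y")
      case True
      \<comment> \<open>To the right of all three supports every ramp is affine, and both the
        coefficients and their first moments with respect to \<open>0\<close>, \<open>1\<close>,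
        \<open>x\<close> sum to zero.\<close>
      have *: "R (1 / \<epsilon> * y + (- a / \<epsilon>)) = (1 / \<epsilon> * y + (- a / \<epsilon>)) + k" if "\<bar>a\<bar> \<le> 1 + \<bar>x\<bar>" for a
        by (rule Rright) (use y True that \<epsilon> in \<open>simp add: N_def field_simps\<close>)
      show ?thesis
        unfolding \<psi>_def by (subst (1 2 3) *) (use \<epsilon> in \<open>auto simp: field_simps\<close>)
    next
      case False
      have "R (1 / \<epsilon> * y + (- a / \<epsilon>)) = 0" if "\<bar>a\<bar> \<le> 1 + \<bar>x\<bar>" for a
        by (rule Rleft) (use y False that \<epsilon> in \<open>simp add: N_def field_simps\<close>)
      from this[of 0] this[of 1] this[of x] show ?thesis
        unfolding \<psi>_def by simp
    qed
    moreover have "0 < N" using \<epsilon> by (simp add: N_def)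
    ultimately have "integral {-N..N} (\<lambda>y. E y * deriv (deriv \<psi>) y) = 0" by (intro ann)
    moreover have "deriv (deriv \<psi>) y = (1 - x) * w 0 y + (x * w 1 y + (- 1) * w x y)" for y
    proof -
      have Rc: "((\<lambda>y. R (1 / \<epsilon> * y + q)) has_real_derivative R1 (1 / \<epsilon> * y + q) * (1 / \<epsilon>)) (at y)" for y q
        by (rule DERIV_chain2[OF R]) (use \<epsilon> in \<open>auto intro!: derivative_eq_intros\<close>)
      have R1c: "((\<lambda>y. R1 (1 / \<epsilon> * y + q)) has_real_derivative \<rho> (1 / \<epsilon> * y + q) * (1 / \<epsilon>)) (at y)" for y q
        by (rule DERIV_chain2[OF R1]) (use \<epsilon> in \<open>auto intro!: derivative_eq_intros\<close>)
      have "deriv \<psi> = (\<lambda>y. (1 - x) * R1 (1 / \<epsilon> * y + (- 0 / \<epsilon>))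
          + (x * R1 (1 / \<epsilon> * y + (- 1 / \<epsilon>)) + (- 1) * R1 (1 / \<epsilon> * y + (- x / \<epsilon>))))"
        using \<epsilon> by (intro ext DERIV_imp_deriv, unfold \<psi>_def)
          (rule derivative_eq_intros Rc refl | simp)+
      moreover have "((\<lambda>y. (1 - x) * R1 (1 / \<epsilon> * y + (- 0 / \<epsilon>))
          + (x * R1 (1 / \<epsilon> * y + (- 1 / \<epsilon>)) + (- 1) * R1 (1 / \<epsilon> * y + (- x / \<epsilon>)))) has_real_derivative
          (1 - x) * w 0 y + (x * w 1 y + (- 1) * w x y)) (at y)"
        unfolding w_def
        by (rule derivative_eq_intros R1c refl | simp add: diff_divide_distrib mult.commute)+
      ultimately show ?thesis by (simp add: DERIV_imp_deriv)
    qed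
    moreover have int: "((\<lambda>y. E y * w a y) has_integral I a) {-N..N}" for a
      unfolding I_def w_def
      using \<epsilon> by (intro integrable_integral integrable_continuous_interval continuous_intros
          continuous_on_subset[OF contE] continuous_on_compose2[OF cont\<rho>]) auto
    moreover have "((\<lambda>y. (1 - x) * (E y * w 0 y) + (x * (E y * w 1 y) + (- 1) * (E y * w x y)))
        has_integral (1 - x) * I 0 + (x * I 1 + (- 1) * I x)) {-N..N}"
      by (intro has_integral_add has_integral_mult_right int)
    ultimately have "(1 - x) * I 0 + x * I 1 - I x = 0"
      by (simp add: integral_unique algebra_simps)
    then have "(1 - x) * E 0 + x * E 1 - E x = (1 - x) * (E 0 - I 0) + x * (E 1 - I 1) + (I x - E x)"
      by (simp add: algebra_simps)
    also have "\<bar>\<dots>\<bar> \<le> \<bar>1 - x\<bar> * \<bar>E 0 - I 0\<bar> + \<bar>x\<bar> * \<bar>E 1 - I 1\<bar> + \<bar>I x - E x\<bar>"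
      by (intro order_trans[OF abs_triangle_ineq] add_mono order_refl) (simp_all add: abs_mult)
    also have "\<dots> \<le> \<bar>1 - x\<bar> * \<eta> + \<bar>x\<bar> * \<eta> + \<eta>"
      using I by (intro add_mono mult_left_mono) (auto simp: abs_minus_commute)
    finally show ?thesis by (simp add: algebra_simps)
  qed
  note bound = this
  have "\<bar>(1 - x) * E 0 + x * E 1 - E x\<bar> \<le> 0 + \<eta>" if "0 < \<eta>" for \<eta>
    using bound[of "\<eta> / (\<bar>1 - x\<bar> + \<bar>x\<bar> + 1)"] that by (simp add: add_pos_nonneg add_nonneg_pos)
  then have "\<bar>(1 - x) * E 0 + x * E 1 - E x\<bar> \<le> 0" by (rule field_le_epsilon)
  then show ?thesis by simp
qed

section \<open>From the weak to the classical equation\<close>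

lemma lborel_integral_eq_integral_Icc:
  fixes f :: "real \<Rightarrow> real"
  assumes "continuous_on UNIV f" and "\<And>x. x \<notin> {a..b} \<Longrightarrow> f x = 0"
  shows "(LINT t|lborel. f t) = integral {a..b} f"
proof -
  have "set_integrable lborel {a..b} f"
    by (intro borel_integrable_atLeastAtMost' continuous_on_subset[OF assms(1)]) simp
  then have "(LINT t:{a..b}|lborel. f t) = integral {a..b} f"
    by (rule set_borel_integral_eq_integral(2))
  moreover have "(\<lambda>t. indicator {a..b} t *\<^sub>R f t) = f"
    using assms(2) by (auto simp: indicator_def fun_eq_iff)
  ultimately show ?thesis by (simp add: set_lebesgue_integral_def)
qed

lemma deriv_eq_0_outside:
  assumes "\<And>x. N < \<bar>x\<bar> \<Longrightarrow> f x = 0" and "N < \<bar>x\<bar>"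
  shows "deriv f x = (0 :: real)"
proof -
  have "((\<lambda>_. 0) has_real_derivative 0) (at x)" by simp
  then have "(f has_real_derivative 0) (at x)"
    by (rule has_field_derivative_transform_within_open[where S = "{x. N < \<bar>x\<bar>}"])
       (use assms in \<open>auto intro!: open_Collect_less continuous_intros\<close>)
  then show ?thesis by (rule DERIV_imp_deriv)
qed

text \<open>With \<open>H\<close> an antiderivative of the reaction term and \<open>J\<close> one of
  \<open>c * \<phi> t - H t\<close>, integration by parts shows that
  \<open>D * \<phi> t powr m - J t\<close> is annihilated by second derivatives of test functions,
  hence affine. In the resulting first-order system only the power of \<open>\<phi>\<close> is
  differentiated, not \<open>\<phi>\<close> itself.\<close>

lemma wave_profile_classical:
  fixes \<phi> :: "real \<Rightarrow> real"
  assumes "1 < m" and cont: "continuous_on UNIV \<phi>" and nonneg: "\<And>t. 0 \<le> \<phi> t"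
    and contb: "continuous_on {0..} b" and contd: "continuous_on {0..} d"
    and weak: "wave_profile_distr D m r b d c \<phi>"
  obtains H where "\<And>t. (H has_real_derivative b (\<phi> (t - c * r)) - d (\<phi> t)) (at t)"
    "\<And>t. ((\<lambda>t. D * \<phi> t powr m) has_real_derivative c * \<phi> t - H t) (at t)"
proof -
  define K where "K t = b (\<phi> (t - c * r)) - d (\<phi> t)" for t
  have contK: "continuous_on UNIV K"
    unfolding K_def
    by (intro continuous_intros continuous_on_compose2[OF contb] continuous_on_compose2[OF contd]
        continuous_on_compose2[OF cont]) (use nonneg in auto)
  obtain H where H: "\<And>t. (H has_real_derivative K t) (at t)"
    using continuous_antiderivative_exists[OF contK] by blast
  have contH: "continuous_on UNIV H" by (rule continuous_on_UNIV_if_DERIV[OF H])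
  have "continuous_on UNIV (\<lambda>t. c * \<phi> t - H t)" by (intro continuous_intros cont contH)
  then obtain J where J: "\<And>t. (J has_real_derivative c * \<phi> t - H t) (at t)"
    using continuous_antiderivative_exists by blast
  have contJ: "continuous_on UNIV J" by (rule continuous_on_UNIV_if_DERIV[OF J])
  define E where "E t = D * \<phi> t powr m - J t" for t
  have contE: "continuous_on UNIV E"
    unfolding E_def by (intro continuous_intros continuous_on_powr' cont contJ) (use assms nonneg in auto)
  have ann: "integral {-N..N} (\<lambda>x. E x * deriv (deriv \<psi>) x) = 0"
    if N: "0 < N" and sm: "smooth_fun \<psi>" and supp: "\<And>x. N - 1 \<le> \<bar>x\<bar> \<Longrightarrow> \<psi> x = 0" for \<psi> N
  proof -
    note \<psi>' = smooth_fun_deriv(2)[OF sm] and sm1 = smooth_fun_deriv(1)[OF sm]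
    note \<psi>'' = smooth_fun_deriv(2)[OF sm1] and sm2 = smooth_fun_deriv(1)[OF sm1]
    have cont\<psi>: "continuous_on UNIV \<psi>" "continuous_on UNIV (deriv \<psi>)" "continuous_on UNIV (deriv (deriv \<psi>))"
      by (rule continuous_on_UNIV_if_DERIV[OF \<psi>'] continuous_on_UNIV_if_DERIV[OF \<psi>'']
          continuous_on_UNIV_if_DERIV[OF smooth_fun_deriv(2)[OF sm2]])+
    have z1: "deriv \<psi> x = 0" if "N - 1 < \<bar>x\<bar>" for x
      using deriv_eq_0_outside[of "N - 1" \<psi> x] supp that by simp
    have z2: "deriv (deriv \<psi>) x = 0" if "N - 1 < \<bar>x\<bar>" for x
      using deriv_eq_0_outside[of "N - 1" "deriv \<psi>" x] z1 that by simp
    define f where "f t = c * \<phi> t * deriv \<psi> t + D * (\<phi> t powr m) * deriv (deriv \<psi>) t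
                        - d (\<phi> t) * \<psi> t + b (\<phi> (t - c * r)) * \<psi> t" for t
    have contf: "continuous_on UNIV f"
      unfolding f_def
      by (intro continuous_intros continuous_on_powr' continuous_on_compose2[OF contb]
          continuous_on_compose2[OF contd] continuous_on_compose2[OF cont] cont cont\<psi>)
         (use assms nonneg in auto)
    have "test_fun \<psi>"
      using sm supp unfolding test_fun_def smooth_fun_def by (metis less_imp_le)
    then have "(LINT t|lborel. f t) = 0"
      using weak unfolding wave_profile_distr_def f_def by blast
    moreover have "f t = 0" if "t \<notin> {-N..N}" for t
    proof -
      have "N - 1 < \<bar>t\<bar>" using that by auto
      then show ?thesis using supp[of t] z1[of t] z2[of t] by (simp add: f_def)
    qed
    ultimately have f0: "integral {-N..N} f = 0"
      using lborel_integral_eq_integral_Icc[OF contf, of "-N" N] by simp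
    \<comment> \<open>All integrations by parts at once: the integrand \<open>f\<close> of the weak
      form differs from \<open>F'\<close> by \<open>E t * deriv (deriv \<psi>) t\<close>, and
      \<open>F\<close> vanishes at both ends.\<close>
    define F where "F t = H t * \<psi> t + J t * deriv \<psi> t" for t
    define F' where "F' t = K t * \<psi> t + H t * deriv \<psi> t
        + ((c * \<phi> t - H t) * deriv \<psi> t + J t * deriv (deriv \<psi>) t)" for t
    have F: "(F has_real_derivative F' t) (at t)" for t
      unfolding F_def F'_def
      by (rule derivative_eq_intros H J \<psi>' \<psi>'' refl | simp)+
    have "(F' has_integral F N - F (- N)) {-N..N}"
      by (rule fundamental_theorem_of_calculus)
         (use N in \<open>auto simp: has_real_derivative_iff_has_vector_derivative[symmetric]
           intro!: has_field_derivative_at_within[OF F]\<close>)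
    moreover have "F N = 0" "F (- N) = 0"
      unfolding F_def using supp[of N] supp[of "-N"] z1[of N] z1[of "-N"] N by auto
    ultimately have F0: "(F' has_integral 0) {-N..N}" by simp
    have "(f has_integral integral {-N..N} f) {-N..N}"
      by (intro integrable_integral integrable_continuous_interval continuous_on_subset[OF contf]) simp
    then have "((\<lambda>t. f t - F' t) has_integral integral {-N..N} f - 0) {-N..N}"
      using F0 by (rule has_integral_diff)
    moreover have "f t - F' t = E t * deriv (deriv \<psi>) t" for t
      unfolding f_def F'_def E_def K_def by (simp add: algebra_simps)
    ultimately show ?thesis using f0 by (simp add: integral_unique)
  qed
  have affine: "E x = (1 - x) * E 0 + x * E 1" for x
    by (rule affine_if_annihilates_second_derivatives[OF contE ann])
  \<comment> \<open>The slope of the affine function is absorbed into the integration constant of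
    \<open>H\<close>; its value at 0 disappears on differentiation.\<close>
  define \<alpha> where "\<alpha> = E 1 - E 0"
  have "(\<lambda>t. D * \<phi> t powr m) = (\<lambda>t. J t + (E 0 + \<alpha> * t))"
  proof
    fix t
    have "D * \<phi> t powr m = J t + E t" by (simp add: E_def)
    then show "D * \<phi> t powr m = J t + (E 0 + \<alpha> * t)"
      using affine[of t] by (simp add: \<alpha>_def algebra_simps)
  qed
  moreover have "((\<lambda>t. J t + (E 0 + \<alpha> * t)) has_real_derivative c * \<phi> t - (H t - \<alpha>)) (at t)" for t
    by (rule derivative_eq_intros J refl | simp)+
  moreover have "((\<lambda>t. H t - \<alpha>) has_real_derivative b (\<phi> (t - c * r)) - d (\<phi> t)) (at t)" for t
    by (rule derivative_eq_intros H refl | simp add: K_def)+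
  ultimately show ?thesis using that[of "\<lambda>t. H t - \<alpha>"] by simp
qed

section \<open>Positive decaying solutions of the linearized delay equation\<close>

text \<open>The equations for \<open>V\<close> and \<open>Y\<close> are a first-order form of
  \<open>A V'' = c v' + H\<close> with \<open>v\<close> close to \<open>V\<close>, and
  \<open>rate\<close> is a perturbed form of
  \<open>A y^2 + c y \<le> \<delta> + \<beta> exp (x h)\<close>. Decay at rate \<open>x\<close>
  makes \<open>V (t - h)\<close> at least \<open>exp (x h)\<close> times \<open>V t\<close>; this
  yields \<open>Y \<ge> k V\<close>, which in turn yields \<open>V' \<le> - y V\<close>.\<close>

lemma decay_rate_improvement:
  fixes V Y v H :: "real \<Rightarrow> real"
  assumes pos: "0 < A" "0 < c" "0 < h" "0 < \<delta>" "0 < \<beta>" "0 \<le> x" "0 \<le> y" "0 < \<epsilon>" "\<epsilon> < 1"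
    and V': "\<And>t. T \<le> t \<Longrightarrow> (V has_real_derivative (c * v t - Y t) / A) (at t)"
    and Y': "\<And>t. T \<le> t \<Longrightarrow> (Y has_real_derivative - H t) (at t)"
    and Vpos: "\<And>t. T \<le> t \<Longrightarrow> 0 < V t"
    and lim: "(V \<longlongrightarrow> 0) at_top" "(Y \<longlongrightarrow> 0) at_top"
    and v: "\<And>t. T \<le> t \<Longrightarrow> (1 - \<epsilon>) * V t \<le> v t \<and> v t \<le> (1 + \<epsilon>) * V t"
    and H: "\<And>t. T + h \<le> t \<Longrightarrow> (1 - \<epsilon>) * (\<delta> * V t + \<beta> * V (t - h)) \<le> H t"
    and rate: "(A * y + c * (1 + \<epsilon>)) * (A * y + c * (1 + \<epsilon>) - c * (1 - \<epsilon>))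
      \<le> A * (1 - \<epsilon>) * (\<delta> + \<beta> * exp (x * h))"
    and decay: "\<And>s t. T \<le> s \<Longrightarrow> s \<le> t \<Longrightarrow> exp (x * (t - s)) * V t \<le> V s"
    and st: "T + h \<le> s" "s \<le> t"
  shows "exp (y * (t - s)) * V t \<le> V s"
proof -
  define k where "k = A * y + c * (1 + \<epsilon>)"
  have k: "0 < k" unfolding k_def using pos by (intro add_nonneg_pos mult_pos_pos) auto
  \<comment> \<open>The excess of \<open>Y\<close> over the multiple of \<open>V\<close> that forces
    decay at rate \<open>y\<close>.\<close>
  define Z where "Z t = Y t - k * V t" for t
  have Z': "(Z has_real_derivative - H t - k * ((c * v t - Y t) / A)) (at t)" if "T + h \<le> t" for t
    unfolding Z_def using that pos by (auto intro!: derivative_eq_intros V' Y')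
  \<comment> \<open>After multiplication by \<open>A\<close> the claim is
    \<open>k^2 V \<le> A H + k c v\<close>; inserting the lower bounds for \<open>H\<close> and
    \<open>v\<close> leaves exactly \<open>rate\<close>.\<close>
  have Z'_le: "- H t - k * ((c * v t - Y t) / A) \<le> k / A * Z t" if t: "T + h \<le> t" for t
  proof -
    have V: "0 < V t" using Vpos[of t] t pos by simp
    have "exp (x * h) * V t \<le> V (t - h)" using decay[of "t - h" t] t pos by simp
    then have "(1 - \<epsilon>) * (\<delta> * V t + \<beta> * (exp (x * h) * V t)) \<le> (1 - \<epsilon>) * (\<delta> * V t + \<beta> * V (t - h))"
      using pos by (intro mult_left_mono add_left_mono) auto
    also have "\<dots> \<le> H t" by (rule H[OF t])
    finally have "A * ((1 - \<epsilon>) * (\<delta> * V t + \<beta> * (exp (x * h) * V t))) \<le> A * H t"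
      using pos by simp
    moreover have "k * (k - c * (1 - \<epsilon>)) * V t \<le> A * (1 - \<epsilon>) * (\<delta> + \<beta> * exp (x * h)) * V t"
      using rate V unfolding k_def by (intro mult_right_mono) auto
    moreover have "k * (c * ((1 - \<epsilon>) * V t)) \<le> k * (c * v t)"
      using v[of t] t pos k by (intro mult_left_mono) auto
    ultimately have "- (A * H t) - k * (c * v t - Y t) \<le> k * Z t"
      unfolding Z_def by (simp add: algebra_simps)
    then have "(- (A * H t) - k * (c * v t - Y t)) / A \<le> k * Z t / A"
      using pos by (simp add: divide_right_mono)
    then show ?thesis using pos by (simp add: field_simps)
  qed
  \<comment> \<open>A negative value of \<open>Z\<close> would grow exponentially in size, whereas
    \<open>Z\<close> tends to 0. Concretely, \<open>exp (- (k / A) * u) * Z u\<close> is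
    nonincreasing with limit 0.\<close>
  have Z_nonneg: "0 \<le> Z t" if t: "T + h \<le> t" for t
  proof -
    define F where "F u = exp (- (k / A) * u) * Z u" for u
    have "F u \<le> F t" if "t \<le> u" for u
    proof (rule DERIV_nonpos_imp_nonincreasing[OF that])
      fix w assume "t \<le> w" "w \<le> u"
      then have w: "T + h \<le> w" using t by simp
      have "(F has_real_derivative exp (- (k / A) * w) *
          ((- H w - k * ((c * v w - Y w) / A)) - k / A * Z w)) (at w)"
        unfolding F_def by (rule derivative_eq_intros Z'[OF w] refl | simp add: algebra_simps)+
      moreover have "exp (- (k / A) * w) *
          ((- H w - k * ((c * v w - Y w) / A)) - k / A * Z w) \<le> 0"
        using Z'_le[OF w] by (intro mult_nonneg_nonpos) auto
      ultimately show "\<exists>y. (F has_real_derivative y) (at w) \<and> y \<le> 0" by blast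
    qed
    then have ev: "\<forall>\<^sub>F u in at_top. F u \<le> F t"
      unfolding eventually_at_top_linorder by blast
    have "(Z \<longlongrightarrow> 0 - k * 0) at_top"
      unfolding Z_def by (intro tendsto_intros lim)
    moreover have "((\<lambda>u. exp (- (k / A) * u)) \<longlongrightarrow> 0) at_top"
      by (rule filterlim_compose[OF exp_at_bot filterlim_tendsto_neg_mult_at_bot[OF tendsto_const]])
         (use k pos in \<open>auto simp: filterlim_ident\<close>)
    ultimately have "(F \<longlongrightarrow> 0 * (0 - k * 0)) at_top"
      unfolding F_def by (intro tendsto_mult)
    then have "0 * (0 - k * 0) \<le> F t"
      by (rule tendsto_upperbound[OF _ ev]) simp
    then show ?thesis by (simp add: F_def zero_le_mult_iff)
  qed
  define G where "G u = exp (y * u) * V u" for u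
  have "G t \<le> G s"
  proof (rule DERIV_nonpos_imp_nonincreasing[OF st(2)])
    fix w assume "s \<le> w" "w \<le> t"
    then have w: "T + h \<le> w" "T \<le> w" using st pos by auto
    have "(G has_real_derivative exp (y * w) * ((c * v w - Y w) / A + y * V w)) (at w)"
      unfolding G_def by (rule derivative_eq_intros V'[OF w(2)] refl | simp add: algebra_simps)+
    moreover have "(c * v w - Y w) / A + y * V w \<le> 0"
    proof -
      have "c * v w \<le> c * ((1 + \<epsilon>) * V w)" using v[OF w(2)] pos by simp
      then have "c * v w - Y w + A * y * V w \<le> 0"
        using Z_nonneg[OF w(1)] unfolding Z_def k_def by (simp add: algebra_simps)
      then have "(c * v w - Y w + A * y * V w) / A \<le> 0" using pos by (simp add: divide_le_0_iff)
      then show ?thesis using pos by (simp add: field_simps)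
    qed
    ultimately show "\<exists>y. (G has_real_derivative y) (at w) \<and> y \<le> 0"
      by (meson exp_ge_zero mult_nonneg_nonpos)
  qed
  then have "exp (- (y * s)) * G t \<le> exp (- (y * s)) * G s" by simp
  moreover have "exp (- (y * s)) * exp (y * t) = exp (y * (t - s))" "exp (- (y * s)) * exp (y * s) = 1"
    by (simp_all add: exp_add[symmetric] right_diff_distrib)
  ultimately show ?thesis
    unfolding G_def by (metis mult.assoc mult_1)
qed

text \<open>The delayed term bounds \<open>Y\<close> below by a multiple of \<open>V\<close> half a
  delay earlier; inserted into the equation for \<open>V\<close>, this bounds \<open>V t\<close>
  below by a fixed multiple of \<open>V (t - h / 4)\<close>. Decay at rate \<open>x\<close> makes
  the same quotient at most \<open>1 / (x * (h / 4))\<close>, impossible for large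
  \<open>x\<close>.\<close>

lemma no_rapidly_decaying_solution:
  fixes V Y v H :: "real \<Rightarrow> real"
  assumes pos: "0 < A" "0 < c" "0 < h" "0 < \<beta>"
    and V': "\<And>t. T \<le> t \<Longrightarrow> (V has_real_derivative (c * v t - Y t) / A) (at t)"
    and Y': "\<And>t. T \<le> t \<Longrightarrow> (Y has_real_derivative - H t) (at t)"
    and Vpos: "\<And>t. T \<le> t \<Longrightarrow> 0 < V t"
    and Vanti: "\<And>s t. T \<le> s \<Longrightarrow> s \<le> t \<Longrightarrow> V t \<le> V s"
    and lim: "(Y \<longlongrightarrow> 0) at_top"
    and v: "\<And>t. T \<le> t \<Longrightarrow> v t \<le> 2 * V t"
    and H: "\<And>t. T + h \<le> t \<Longrightarrow> \<beta> * V (t - h) \<le> H t"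
    and x: "0 \<le> x" "A + c * h / 2 < (h / 4) * (h / 2 * \<beta>) * (x * (h / 4))"
    and decay: "\<And>s t. T \<le> s \<Longrightarrow> s \<le> t \<Longrightarrow> exp (x * (t - s)) * V t \<le> V s"
  shows False
proof -
  have Y_nonneg: "0 \<le> Y t" if t: "T + h \<le> t" for t
  proof -
    have "Y u \<le> Y t" if "t \<le> u" for u
    proof (rule DERIV_nonpos_imp_nonincreasing[OF that])
      fix w assume "t \<le> w" "w \<le> u"
      then have w: "T + h \<le> w" using t by simp
      have "0 \<le> \<beta> * V (w - h)" using Vpos[of "w - h"] w pos by simp
      then have "- H w \<le> 0" using H[OF w] by linarith
      then show "\<exists>y. (Y has_real_derivative y) (at w) \<and> y \<le> 0"
        using Y'[of w] w pos by (intro exI[of _ "- H w"]) simp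
    qed
    then have "\<forall>\<^sub>F u in at_top. Y u \<le> Y t" unfolding eventually_at_top_linorder by blast
    then show ?thesis by (rule tendsto_upperbound[OF lim]) simp
  qed
  \<comment> \<open>Half of the delay is spent here: at the intermediate point
    \<open>z < t + h / 2\<close> monotonicity gives
    \<open>V (z - h) \<ge> V (t - h / 2)\<close>.\<close>
  have Y_ge: "h / 2 * \<beta> * V (t - h / 2) \<le> Y t" if t: "T + h \<le> t" for t
  proof -
    obtain z where z: "t < z" "z < t + h / 2" "Y (t + h / 2) - Y t = (t + h / 2 - t) * (- H z)"
      using MVT2[of t "t + h / 2" Y "\<lambda>z. - H z"] Y' t pos by auto
    have "\<beta> * V (t - h / 2) \<le> \<beta> * V (z - h)"
      using z t pos by (intro mult_left_mono Vanti) auto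
    also have "\<dots> \<le> H z" using H[of z] z t by simp
    finally have "h / 2 * (\<beta> * V (t - h / 2)) \<le> h / 2 * H z"
      using pos by (intro mult_left_mono) auto
    moreover have "Y t = Y (t + h / 2) + h / 2 * H z" using z(3) by simp
    moreover have "0 \<le> Y (t + h / 2)" using Y_nonneg t pos by simp
    ultimately show ?thesis by (simp only: mult.assoc)
  qed
  define t where "t = T + 2 * h"
  have t: "T + h \<le> t" "T \<le> t - h / 4" using pos by (auto simp: t_def)
  obtain z where z: "t < z" "z < t + h / 4" "V (t + h / 4) - V t = (t + h / 4 - t) * ((c * v z - Y z) / A)"
    using MVT2[of t "t + h / 4" V "\<lambda>z. (c * v z - Y z) / A"] V' t pos by auto
  have V: "0 < V t" "0 < V (t + h / 4)" using Vpos t pos by auto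
  \<comment> \<open>Another quarter of the delay is spent: \<open>z < t + h / 4\<close> gives
    \<open>V (z - h / 2) \<ge> V (t - h / 4)\<close>.\<close>
  have "h / 2 * \<beta> * V (t - h / 4) \<le> h / 2 * \<beta> * V (z - h / 2)"
    using z t pos by (intro mult_left_mono Vanti) auto
  also have "\<dots> \<le> Y z" using Y_ge[of z] z t by simp
  finally have Yz: "h / 2 * \<beta> * V (t - h / 4) \<le> Y z" .
  have "v z \<le> 2 * V z" using v z t pos by simp
  also have "\<dots> \<le> 2 * V t" using Vanti[of t z] z t pos by simp
  finally have "c * v z \<le> c * (2 * V t)" using pos by simp
  then have "h / 4 * (h / 2 * \<beta> * V (t - h / 4) - c * (2 * V t)) \<le> h / 4 * (Y z - c * v z)"
    using Yz pos by (intro mult_left_mono diff_mono) auto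
  also have "\<dots> = A * (V t - V (t + h / 4))" using z(3) pos by (simp add: field_simps)
  also have "\<dots> \<le> A * V t" using V pos by simp
  finally have 1: "(h / 4) * (h / 2 * \<beta>) * V (t - h / 4) \<le> (A + c * h / 2) * V t"
    by (simp add: algebra_simps)
  have "x * (h / 4) * V t \<le> exp (x * (h / 4)) * V t"
  proof (rule mult_right_mono)
    show "x * (h / 4) \<le> exp (x * (h / 4))" using exp_ge_add_one_self[of "x * (h / 4)"] by linarith
  qed (use V in simp)
  also have "\<dots> \<le> V (t - h / 4)" using decay[of "t - h / 4" t] t pos by simp
  finally have "(h / 4) * (h / 2 * \<beta>) * (x * (h / 4) * V t) \<le> (h / 4) * (h / 2 * \<beta>) * V (t - h / 4)"
    using pos by (intro mult_left_mono) auto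
  then have "((h / 4) * (h / 2 * \<beta>) * (x * (h / 4))) * V t \<le> (A + c * h / 2) * V t"
    using order_trans[OF _ 1] by (simp only: mult.assoc)
  then show False using x V by simp
qed

text \<open>The relative margin \<open>\<theta>\<close> lets \<open>decay_rate_improvement\<close>
  raise the rate from \<open>x\<close> to \<open>x + \<eta>\<close> with one \<open>\<eta>\<close>
  for all \<open>x\<close>. After enough rounds, each starting one delay later, the rate contradicts
  \<open>no_rapidly_decaying_solution\<close>.\<close>

lemma no_positive_decaying_solution:
  fixes V Y v H :: "real \<Rightarrow> real"
  assumes pos: "0 < A" "0 < c" "0 < h" "0 < \<delta>" "0 < \<beta>" "0 < \<theta>"
    and char: "\<And>x. 0 \<le> x \<Longrightarrow> A * x\<^sup>2 + c * x \<le> (1 - \<theta>) * (\<delta> + \<beta> * exp (x * h))"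
    and V': "\<And>t. S \<le> t \<Longrightarrow> (V has_real_derivative (c * v t - Y t) / A) (at t)"
    and Y': "\<And>t. S \<le> t \<Longrightarrow> (Y has_real_derivative - H t) (at t)"
    and Vpos: "\<And>t. S \<le> t \<Longrightarrow> 0 < V t"
    and Vanti: "\<And>s t. S \<le> s \<Longrightarrow> s \<le> t \<Longrightarrow> V t \<le> V s"
    and lim: "(V \<longlongrightarrow> 0) at_top" "(Y \<longlongrightarrow> 0) at_top"
    and v: "\<And>\<epsilon>. 0 < \<epsilon> \<Longrightarrow> \<forall>\<^sub>F t in at_top. (1 - \<epsilon>) * V t \<le> v t \<and> v t \<le> (1 + \<epsilon>) * V t"
    and H: "\<And>\<epsilon>. 0 < \<epsilon> \<Longrightarrow> \<forall>\<^sub>F t in at_top. (1 - \<epsilon>) * (\<delta> * V t + \<beta> * V (t - h)) \<le> H t"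
  shows False
proof -
  define \<Phi> where "\<Phi> x = \<delta> + \<beta> * exp (x * h)" for x
  \<comment> \<open>Chosen so that \<open>\<Phi> x \<ge> \<beta> * (x * h)\<close> pays for the
    linear terms and \<open>\<Phi> x \<ge> \<beta>\<close> for the constants in
    \<open>A * x + c + x + 1\<close>.\<close>
  define M where "M = (A + 1) / (\<beta> * h) + (c + 1) / \<beta>"
  have M: "0 < M" unfolding M_def using pos by (intro add_pos_pos divide_pos_pos) auto
  have M_bound: "A * x + c + x + 1 \<le> M * \<Phi> x" if "0 \<le> x" for x
  proof -
    have "A * x + c + x + 1 = (A + 1) / (\<beta> * h) * (\<beta> * (x * h)) + (c + 1) / \<beta> * \<beta>"
      using pos by (simp add: field_simps)
    also have "\<dots> \<le> (A + 1) / (\<beta> * h) * \<Phi> x + (c + 1) / \<beta> * \<Phi> x"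
    proof (intro add_mono mult_left_mono)
      have "1 + x * h \<le> exp (x * h)" by (rule exp_ge_add_one_self)
      then have "\<beta> * (1 + x * h) \<le> \<beta> * exp (x * h)" using pos by simp
      moreover have "0 \<le> \<beta> * (x * h)" using pos that by simp
      ultimately show "\<beta> * (x * h) \<le> \<Phi> x" "\<beta> \<le> \<Phi> x"
        using pos unfolding \<Phi>_def by (simp_all add: algebra_simps)
    qed (use pos in auto)
    finally show ?thesis unfolding M_def by (simp add: algebra_simps)
  qed
  \<comment> \<open>The error budget: one half of \<open>\<theta>\<close> covers the perturbation
    \<open>\<tau> * M\<close>, the other half covers \<open>\<epsilon>\<close>. The remaining bounds
    on \<open>\<epsilon>\<close> and \<open>\<eta>\<close> ensure
    \<open>A * \<eta> + c * \<epsilon> \<le> \<tau>\<close> and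
    \<open>A * \<eta> + 2 * c * \<epsilon> \<le> A * \<tau>\<close>.\<close>
  define \<tau> where "\<tau> = min 1 (\<theta> / (2 * M))"
  have \<tau>: "0 < \<tau>" "\<tau> \<le> 1" "\<tau> * M \<le> \<theta> / 2"
    using pos M unfolding \<tau>_def by (auto simp: min_def field_simps)
  define \<epsilon> where "\<epsilon> = min (min (\<theta> / 2) (1 / 2)) (min (\<tau> / (2 * c)) (\<tau> * A / (4 * c)))"
  have \<epsilon>: "0 < \<epsilon>" "\<epsilon> \<le> \<theta> / 2" "\<epsilon> \<le> 1 / 2" "\<epsilon> \<le> \<tau> / (2 * c)" "\<epsilon> \<le> \<tau> * A / (4 * c)"
    using pos \<tau> unfolding \<epsilon>_def by auto
  define \<eta> where "\<eta> = min (\<tau> / 2) (\<tau> / (2 * A))"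
  have \<eta>: "0 < \<eta>" "\<eta> \<le> \<tau> / 2" "\<eta> \<le> \<tau> / (2 * A)"
    using pos \<tau> unfolding \<eta>_def by auto
  have rate: "(A * (x + \<eta>) + c * (1 + \<epsilon>)) * (A * (x + \<eta>) + c * (1 + \<epsilon>) - c * (1 - \<epsilon>))
      \<le> A * (1 - \<epsilon>) * (\<delta> + \<beta> * exp (x * h))" if x: "0 \<le> x" for x
  proof -
    have a1: "A * \<eta> + c * \<epsilon> \<le> \<tau>" using \<eta>(3) \<epsilon>(4) pos by (simp add: field_simps)
    have a2: "A * \<eta> + 2 * c * \<epsilon> \<le> A * \<tau>"
    proof -
      have "A * \<eta> \<le> A * (\<tau> / 2)" using \<eta>(2) pos by simp
      moreover have "2 * c * \<epsilon> \<le> A * (\<tau> / 2)" using \<epsilon>(5) pos by (simp add: field_simps)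
      ultimately show ?thesis by simp
    qed
    have "(A * (x + \<eta>) + c * (1 + \<epsilon>)) * (A * (x + \<eta>) + c * (1 + \<epsilon>) - c * (1 - \<epsilon>))
        = (A * x + c + (A * \<eta> + c * \<epsilon>)) * (A * x + (A * \<eta> + 2 * c * \<epsilon>))"
      by (simp add: algebra_simps)
    also have "\<dots> \<le> (A * x + c + \<tau>) * (A * x + A * \<tau>)"
      using a1 a2 x pos \<eta> \<epsilon> \<tau> by (intro mult_mono add_left_mono) auto
    also have "\<dots> = A * (A * x\<^sup>2 + c * x + \<tau> * (A * x + c + x + \<tau>))"
      by (simp add: algebra_simps power2_eq_square)
    also have "\<dots> \<le> A * ((1 - \<theta>) * \<Phi> x + \<tau> * (M * \<Phi> x))"
      using M_bound[OF x] char[OF x] \<tau> pos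
      by (intro mult_left_mono add_mono) (auto simp: \<Phi>_def)
    also have "\<dots> = A * (((1 - \<theta>) + \<tau> * M) * \<Phi> x)" by (simp add: algebra_simps)
    also have "\<dots> \<le> A * ((1 - \<epsilon>) * \<Phi> x)"
    proof (intro mult_left_mono mult_right_mono)
      show "1 - \<theta> + \<tau> * M \<le> 1 - \<epsilon>" using \<tau>(3) \<epsilon>(2) by linarith
      show "0 \<le> \<Phi> x" unfolding \<Phi>_def using pos by (simp add: add_nonneg_nonneg)
    qed (use pos in simp)
    finally show ?thesis unfolding \<Phi>_def by (simp add: mult.assoc)
  qed
  have "\<forall>\<^sub>F t in at_top. S \<le> t \<and> ((1 - \<epsilon>) * V t \<le> v t \<and> v t \<le> (1 + \<epsilon>) * V t)
      \<and> (1 - \<epsilon>) * (\<delta> * V t + \<beta> * V (t - h)) \<le> H t"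
    by (intro eventually_conj eventually_ge_at_top v H \<epsilon>)
  then obtain T where T: "\<And>t. T \<le> t \<Longrightarrow> S \<le> t \<and> ((1 - \<epsilon>) * V t \<le> v t \<and> v t \<le> (1 + \<epsilon>) * V t)
      \<and> (1 - \<epsilon>) * (\<delta> * V t + \<beta> * V (t - h)) \<le> H t"
    unfolding eventually_at_top_linorder by blast
  have decay: "\<exists>T1\<ge>T. \<forall>s t. T1 \<le> s \<and> s \<le> t \<longrightarrow> exp (real n * \<eta> * (t - s)) * V t \<le> V s" for n
  proof (induction n)
    case 0
    then show ?case using Vanti T by (intro exI[of _ T]) auto
  next
    case (Suc n)
    then obtain T1 where T1: "T \<le> T1"
      "\<And>s t. T1 \<le> s \<Longrightarrow> s \<le> t \<Longrightarrow> exp (real n * \<eta> * (t - s)) * V t \<le> V s" by blast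
    have "exp ((real n * \<eta> + \<eta>) * (t - s)) * V t \<le> V s" if "T1 + h \<le> s" "s \<le> t" for s t
    proof (rule decay_rate_improvement[where x = "real n * \<eta>" and T = T1 and A = A and c = c
          and h = h and \<delta> = \<delta> and \<beta> = \<beta> and \<epsilon> = \<epsilon> and v = v and Y = Y and H = H])
      show "(A * (real n * \<eta> + \<eta>) + c * (1 + \<epsilon>)) * (A * (real n * \<eta> + \<eta>) + c * (1 + \<epsilon>) - c * (1 - \<epsilon>))
          \<le> A * (1 - \<epsilon>) * (\<delta> + \<beta> * exp (real n * \<eta> * h))"
        by (rule rate) (use \<eta> in simp)
      show "(V has_real_derivative (c * v t - Y t) / A) (at t)"
        "(Y has_real_derivative - H t) (at t)" "0 < V t"
        "(1 - \<epsilon>) * V t \<le> v t \<and> v t \<le> (1 + \<epsilon>) * V t" if "T1 \<le> t" for t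
        using that T1(1) T[of t] V' Y' Vpos by auto
      show "(1 - \<epsilon>) * (\<delta> * V t + \<beta> * V (t - h)) \<le> H t" if "T1 + h \<le> t" for t
        using that T1(1) T[of t] pos by auto
    qed (use pos \<eta> \<epsilon> lim T1(2) that in auto)
    moreover have "real n * \<eta> + \<eta> = real (Suc n) * \<eta>" by (simp add: algebra_simps)
    ultimately show ?case
      using T1(1) pos by (intro exI[of _ "T1 + h"]) auto
  qed
  \<comment> \<open>\<open>K < real n\<close> is the largeness condition of
    \<open>no_rapidly_decaying_solution\<close> for the rate \<open>real n * \<eta>\<close>, with
    \<open>\<beta> / 2\<close> in place of \<open>\<beta>\<close>; the half comes from
    \<open>\<epsilon> \<le> 1 / 2\<close>.\<close>
  define K where "K = (A + c * h / 2) / ((h / 4) * (h / 2 * (\<beta> / 2)) * (h / 4) * \<eta>)"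
  obtain n where n: "K < real n" using reals_Archimedean2 by blast
  obtain T1 where T1: "T \<le> T1"
    "\<And>s t. T1 \<le> s \<Longrightarrow> s \<le> t \<Longrightarrow> exp (real n * \<eta> * (t - s)) * V t \<le> V s"
    using decay[of n] by blast
  show False
  proof (rule no_rapidly_decaying_solution[where x = "real n * \<eta>" and T = T1 and A = A and c = c
          and h = h and \<beta> = "\<beta> / 2" and v = v and Y = Y and H = H and V = V])
    show "A + c * h / 2 < h / 4 * (h / 2 * (\<beta> / 2)) * (real n * \<eta> * (h / 4))"
      using n pos \<eta>(1) unfolding K_def by (simp add: field_simps)
    show "(V has_real_derivative (c * v t - Y t) / A) (at t)"
        "(Y has_real_derivative - H t) (at t)" "0 < V t" if "T1 \<le> t" for t
      using that T1(1) T[of t] V' Y' Vpos by auto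
    show "V t \<le> V s" if "T1 \<le> s" "s \<le> t" for s t
      using that T1(1) T[of s] Vanti by auto
    show "v t \<le> 2 * V t" if "T1 \<le> t" for t
    proof -
      have "(1 + \<epsilon>) * V t \<le> 2 * V t"
        using \<epsilon>(3) Vpos[of t] T[of t] that T1(1) by (intro mult_right_mono) auto
      then show ?thesis using T[of t] that T1(1) by auto
    qed
    show "\<beta> / 2 * V (t - h) \<le> H t" if "T1 + h \<le> t" for t
    proof -
      have "0 < V t" "0 < V (t - h)"
        using Vpos T[of t] T[of "t - h"] that T1(1) pos by auto
      then have "1 / 2 * (\<beta> * V (t - h)) \<le> (1 - \<epsilon>) * (\<delta> * V t + \<beta> * V (t - h))"
        using \<epsilon>(3) pos by (intro mult_mono) auto
      then show ?thesis using T[of t] that T1(1) pos by auto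
    qed
  qed (use pos \<eta> lim T1(2) in auto)
qed

section \<open>The threshold speed\<close>

text \<open>For \<open>\<omega> \<ge> -2\<close> the right-hand side is nonpositive, so roots lie
  left of \<open>-2\<close>, where \<open>exp (- \<omega>) * (- 2 - \<omega>)\<close> is strictly
  decreasing. This justifies the definite description in \<open>omega_k\<close>.\<close>

lemma omega_k_root:
  assumes "\<beta> < 0" "0 < \<delta>"
  shows "omega_k \<beta> \<delta> < -2" and "2 * \<delta> = \<beta> * exp (- omega_k \<beta> \<delta>) * (2 + omega_k \<beta> \<delta>)"
proof -
  have less: "\<omega> < -2" if "2 * \<delta> = \<beta> * exp (- \<omega>) * (2 + \<omega>)" for \<omega>
  proof (rule ccontr)
    assume "\<not> \<omega> < -2"
    then have "\<beta> * exp (- \<omega>) * (2 + \<omega>) \<le> 0" using assms by (intro mult_nonpos_nonneg) auto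
    then show False using that assms by simp
  qed
  have uniq: False if "2 * \<delta> = \<beta> * exp (- v) * (2 + v)" "2 * \<delta> = \<beta> * exp (- w) * (2 + w)" "v < w" for v w
  proof -
    have "exp (- w) * (- 2 - w) < exp (- v) * (- 2 - v)"
      using that less[OF that(1)] less[OF that(2)] by (intro mult_strict_mono) auto
    then have "\<beta> * (exp (- v) * (- 2 - v)) < \<beta> * (exp (- w) * (- 2 - w))" using assms by simp
    then show False using that by (simp add: algebra_simps)
  qed
  \<comment> \<open>Chosen so that \<open>- \<beta> * (X - 2) = 2 * \<delta>\<close>; the factor
    \<open>exp X \<ge> 1\<close> then lifts the function to at least
    \<open>2 * \<delta>\<close>.\<close>
  define X where "X = 2 + 2 * \<delta> / (- \<beta>)"
  have X: "2 \<le> X" using assms by (simp add: X_def divide_nonneg_neg)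
  have "\<exists>x. 2 \<le> x \<and> x \<le> X \<and> - \<beta> * exp x * (x - 2) = 2 * \<delta>"
  proof (rule IVT')
    have "- \<beta> * exp X * (X - 2) = exp X * (2 * \<delta>)" using assms by (simp add: X_def)
    moreover have "1 * (2 * \<delta>) \<le> exp X * (2 * \<delta>)" using assms X by (intro mult_right_mono) auto
    ultimately show "2 * \<delta> \<le> - \<beta> * exp X * (X - 2)" by simp
    show "continuous_on {2..X} (\<lambda>x. - \<beta> * exp x * (x - 2))" by (intro continuous_intros)
  qed (use assms X in auto)
  then obtain x where x: "- \<beta> * exp x * (x - 2) = 2 * \<delta>" by blast
  have root: "2 * \<delta> = \<beta> * exp (- (- x)) * (2 + (- x))" using x by (simp add: algebra_simps)
  have "\<exists>!\<omega>. \<omega> < 0 \<and> 2 * \<delta> = \<beta> * exp (- \<omega>) * (2 + \<omega>)"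
  proof (rule ex1I[of _ "- x"])
    show "- x < 0 \<and> 2 * \<delta> = \<beta> * exp (- (- x)) * (2 + (- x))"
      using root less[OF root] by simp
    show "\<omega> = - x" if "\<omega> < 0 \<and> 2 * \<delta> = \<beta> * exp (- \<omega>) * (2 + \<omega>)" for \<omega>
      using uniq[OF conjunct2[OF that] root] uniq[OF root conjunct2[OF that]]
      by (meson linorder_neqE_linordered_idom)
  qed
  then have "omega_k \<beta> \<delta> < 0 \<and> 2 * \<delta> = \<beta> * exp (- omega_k \<beta> \<delta>) * (2 + omega_k \<beta> \<delta>)"
    unfolding omega_k_def by (rule theI')
  then show "omega_k \<beta> \<delta> < -2" and "2 * \<delta> = \<beta> * exp (- omega_k \<beta> \<delta>) * (2 + omega_k \<beta> \<delta>)"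
    using less by blast+
qed

text \<open>The left-hand parabola touches the right-hand side at \<^term>\<open>x = a\<close>.\<close>
lemma tangent_parabola_below_exp:
  fixes a x :: real
  assumes "2 \<le> a" "0 \<le> x"
  shows "x\<^sup>2 \<le> 2 * a * ((a - 2) / 2 + exp (x - a))"
proof -
  have "x\<^sup>2 / (2 * a) \<le> (a - 2) / 2 + exp (x - a)"
  proof (cases "a \<le> x")
    case True
    \<comment> \<open>Beyond the point of contact, \<open>a \<ge> 1\<close> reduces the claim to the
      quadratic Taylor bound for \<open>exp u\<close>.\<close>
    define u where "u = x - a"
    have u: "0 \<le> u" "x = a + u" using True by (auto simp: u_def)
    have "x\<^sup>2 / (2 * a) = a / 2 + u + u\<^sup>2 / (2 * a)"
      using assms u by (simp add: field_simps power2_eq_square)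
    also have "u\<^sup>2 / (2 * a) \<le> u\<^sup>2 / 2"
      using assms by (intro divide_left_mono) auto
    also have "a / 2 + u + u\<^sup>2 / 2 = (a - 2) / 2 + (1 + u + u\<^sup>2 / 2)" by (simp add: field_simps)
    also have "1 + u + u\<^sup>2 / 2 \<le> exp u" by (rule exp_lower_Taylor_quadratic[OF u(1)])
    finally show ?thesis by (simp add: u_def)
  next
    case False
    define y where "y = a - x"
    have y: "0 \<le> y" "x = a - y" "y \<le> a" using False assms by (auto simp: y_def)
    have eq: "x\<^sup>2 / (2 * a) = (a - 2) / 2 + (1 - y + y\<^sup>2 / (2 * a))"
      using assms unfolding y(2) by (simp add: field_simps power2_eq_square)
    \<comment> \<open>For \<open>y \<le> 2\<close>, \<open>2 * a \<ge> 4\<close> bounds the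
      left-hand side by the square of \<open>1 - y / 2\<close>; for larger \<open>y\<close>,
      \<open>y \<le> a\<close> makes it at most \<open>1 - y / 2 < 0\<close>.\<close>
    have "1 - y + y\<^sup>2 / (2 * a) \<le> exp (- y)"
    proof (cases "y \<le> 2")
      case True
      have "y\<^sup>2 / (2 * a) \<le> y\<^sup>2 / 4"
        using assms by (intro divide_left_mono) auto
      then have "1 - y + y\<^sup>2 / (2 * a) \<le> (1 - y / 2)\<^sup>2"
        by (simp add: power2_diff power_divide)
      also have "\<dots> \<le> (exp (- y / 2))\<^sup>2"
        using True exp_ge_add_one_self[of "- y / 2"] by (intro power_mono) auto
      also have "\<dots> = exp (- y)" by (simp add: power2_eq_square exp_add[symmetric])
      finally show ?thesis .
    next
      case False
      have "y\<^sup>2 \<le> y * a" using y by (simp add: power2_eq_square mult_left_mono)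
      then have "y\<^sup>2 / (2 * a) \<le> y / 2" using assms by (simp add: field_simps)
      then show ?thesis using False exp_ge_zero[of "- y"] by linarith
    qed
    then show ?thesis using eq by (simp add: y_def)
  qed
  then show ?thesis using assms by (simp add: field_simps)
qed

text \<open>With \<open>a = - omega_k \<beta> \<delta>\<close>, the root equation reads
  \<open>\<delta> = - \<beta> * exp a * ((a - 2) / 2)\<close>, so
  \<open>\<delta> - \<beta> * exp x\<close> is a multiple of
  \<open>(a - 2) / 2 + exp (x - a)\<close>. The square of \<open>mu_k\<close> supplies exactly the
  factor that reduces the claim to \<open>tangent_parabola_below_exp\<close>.\<close>

lemma mu_k_pos_and_minimal:
  assumes "\<beta> < 0" "0 < \<delta>" "0 < \<kappa>" "0 < D" "0 < m"
  shows "0 < mu_k D m \<kappa> \<beta> \<delta>"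
    and "0 \<le> x \<Longrightarrow> D * m * \<kappa> powr (m - 1) * x\<^sup>2 \<le> (mu_k D m \<kappa> \<beta> \<delta>)\<^sup>2 * (\<delta> - \<beta> * exp x)"
proof -
  define a where "a = - omega_k \<beta> \<delta>"
  define A where "A = D * m * \<kappa> powr (m - 1)"
  have a: "2 < a" "2 * \<delta> = - \<beta> * exp a * (a - 2)"
    using omega_k_root[OF assms(1,2)] by (auto simp: a_def algebra_simps)
  have A: "0 < A" using assms by (simp add: A_def)
  have mu: "mu_k D m \<kappa> \<beta> \<delta> = sqrt (2 * A * a / (- \<beta>)) * exp (- a / 2)"
    unfolding mu_k_def a_def A_def by (simp add: mult.assoc)
  show "0 < mu_k D m \<kappa> \<beta> \<delta>"
    unfolding mu using A a assms by (simp add: divide_pos_neg)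
  have mu2: "(mu_k D m \<kappa> \<beta> \<delta>)\<^sup>2 = 2 * A * a / (- \<beta>) * exp (- a)"
  proof -
    have "(exp (- a / 2))\<^sup>2 = exp (- a)" by (simp add: power2_eq_square exp_add[symmetric])
    moreover have "0 \<le> 2 * A * a / (- \<beta>)" using A a assms by (intro divide_nonneg_nonneg) auto
    ultimately show ?thesis unfolding mu by (simp only: power_mult_distrib real_sqrt_pow2)
  qed
  assume x: "0 \<le> x"
  have \<delta>: "\<delta> = - \<beta> * exp a * ((a - 2) / 2)" using a(2) by simp
  have "exp (- a) * exp a = 1" "exp (- a) * exp x = exp (x - a)" by (simp_all add: exp_add[symmetric])
  moreover have "2 * A * a / (- \<beta>) * exp (- a) * (- \<beta> * exp a * ((a - 2) / 2) - \<beta> * exp x)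
      = A * (2 * a * (exp (- a) * exp a * ((a - 2) / 2) + exp (- a) * exp x))"
    using assms(1) by (simp add: field_simps)
  ultimately have "(mu_k D m \<kappa> \<beta> \<delta>)\<^sup>2 * (\<delta> - \<beta> * exp x) = A * (2 * a * ((a - 2) / 2 + exp (x - a)))"
    unfolding mu2 \<delta>[symmetric] by simp
  moreover have "A * x\<^sup>2 \<le> A * (2 * a * ((a - 2) / 2 + exp (x - a)))"
    using tangent_parabola_below_exp[of a x] a x A by (intro mult_left_mono) auto
  ultimately show "D * m * \<kappa> powr (m - 1) * x\<^sup>2 \<le> (mu_k D m \<kappa> \<beta> \<delta>)\<^sup>2 * (\<delta> - \<beta> * exp x)"
    by (simp add: A_def)
qed

text \<open>An explicit majorant of the optimal threshold, with the same leading term as \<open>r \<rightarrow> \<infinity>\<close>.\<close>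
definition c_kappa :: "real \<Rightarrow> real \<Rightarrow> real \<Rightarrow> real \<Rightarrow> real \<Rightarrow> real \<Rightarrow> ereal" where
  "c_kappa D m \<kappa> r \<beta> \<delta> =
    (if 1 < r * \<bar>\<beta>\<bar> then ereal (mu_k D m \<kappa> \<beta> \<delta> / (r * sqrt (1 - 1 / (r * \<bar>\<beta>\<bar>)))) else \<infinity>)"

lemma c_kappa_asymptotics:
  assumes "\<beta> < 0" "0 < \<delta>" "0 < \<kappa>" "0 < D" "0 < m"
  shows "0 < r \<Longrightarrow> 0 < c_kappa D m \<kappa> r \<beta> \<delta>"
    and "\<forall>\<^sub>F r in at_top. c_kappa D m \<kappa> r \<beta> \<delta> < \<infinity>"
    and "((\<lambda>r. r * real_of_ereal (c_kappa D m \<kappa> r \<beta> \<delta>)) \<longlongrightarrow> mu_k D m \<kappa> \<beta> \<delta>) at_top"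
proof -
  show "0 < c_kappa D m \<kappa> r \<beta> \<delta>" if "0 < r"
    using mu_k_pos_and_minimal(1)[OF assms] that by (auto simp: c_kappa_def divide_simps)
  have "filterlim (\<lambda>r. r * \<bar>\<beta>\<bar>) at_top at_top"
    by (rule filterlim_at_top_mult_tendsto_pos[OF tendsto_const]) (use assms in \<open>auto simp: filterlim_ident\<close>)
  then have ev: "\<forall>\<^sub>F r in at_top. 1 < r * \<bar>\<beta>\<bar>" by (simp add: filterlim_at_top_dense)
  then show "\<forall>\<^sub>F r in at_top. c_kappa D m \<kappa> r \<beta> \<delta> < \<infinity>"
    by eventually_elim (simp add: c_kappa_def)
  have "((\<lambda>r. 1 / (r * \<bar>\<beta>\<bar>)) \<longlongrightarrow> 0) at_top"
    by (rule tendsto_divide_0[OF tendsto_const]) 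
       (use \<open>filterlim (\<lambda>r. r * \<bar>\<beta>\<bar>) at_top at_top\<close> in \<open>rule filterlim_at_top_imp_at_infinity\<close>)
  then have "((\<lambda>r. mu_k D m \<kappa> \<beta> \<delta> / sqrt (1 - 1 / (r * \<bar>\<beta>\<bar>))) \<longlongrightarrow> mu_k D m \<kappa> \<beta> \<delta> / sqrt (1 - 0)) at_top"
    by (intro tendsto_intros) auto
  then have "((\<lambda>r. mu_k D m \<kappa> \<beta> \<delta> / sqrt (1 - 1 / (r * \<bar>\<beta>\<bar>))) \<longlongrightarrow> mu_k D m \<kappa> \<beta> \<delta>) at_top" by simp
  moreover have "\<forall>\<^sub>F r in at_top. mu_k D m \<kappa> \<beta> \<delta> / sqrt (1 - 1 / (r * \<bar>\<beta>\<bar>))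
      = r * real_of_ereal (c_kappa D m \<kappa> r \<beta> \<delta>)"
    using ev eventually_gt_at_top[of 0] by eventually_elim (simp add: c_kappa_def)
  ultimately show "((\<lambda>r. r * real_of_ereal (c_kappa D m \<kappa> r \<beta> \<delta>)) \<longlongrightarrow> mu_k D m \<kappa> \<beta> \<delta>) at_top"
    by (rule Lim_transform_eventually)
qed

text \<open>The two terms on the left are absorbed separately: the quadratic one takes the fraction
  \<open>\<mu>^2 / (c r)^2\<close> of the right-hand side, the linear one the fraction
  \<open>q = 1 / (r |\<beta>|)\<close>. The speed condition says that these add up to less than 1,
  and \<open>\<theta>\<close> is what remains.\<close>

lemma characteristic_margin:
  assumes "\<beta> < 0" "0 < \<delta>" "0 < \<kappa>" "0 < D" "0 < m" "0 < r" "0 < c"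
    and c: "c_kappa D m \<kappa> r \<beta> \<delta> < ereal c"
  obtains \<theta> where "0 < \<theta>"
    "\<And>x. 0 \<le> x \<Longrightarrow> D * m * \<kappa> powr (m - 1) * x\<^sup>2 + c * x \<le> (1 - \<theta>) * (\<delta> + (- \<beta>) * exp (x * (c * r)))"
proof -
  define \<mu> where "\<mu> = mu_k D m \<kappa> \<beta> \<delta>"
  have \<mu>: "0 < \<mu>" using mu_k_pos_and_minimal(1)[OF assms(1-5)] by (simp add: \<mu>_def)
  define q where "q = 1 / (r * \<bar>\<beta>\<bar>)"
  have rb: "1 < r * \<bar>\<beta>\<bar>" and c': "\<mu> / (r * sqrt (1 - q)) < c"
    using c by (auto simp: c_kappa_def \<mu>_def q_def split: if_splits)
  have q: "q < 1" "0 < q" using rb by (auto simp: q_def)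
  have cr: "0 < c * r" using assms by simp
  have "\<mu> < sqrt (1 - q) * (c * r)" using c' q assms by (simp add: field_simps)
  then have "\<mu>\<^sup>2 < (sqrt (1 - q) * (c * r))\<^sup>2" using \<mu> by (intro power_strict_mono) auto
  also have "\<dots> = (1 - q) * (c * r)\<^sup>2" using q by (simp add: power_mult_distrib)
  finally have less: "\<mu>\<^sup>2 / (c * r)\<^sup>2 < 1 - q" using cr by (subst pos_divide_less_eq) auto
  define \<theta> where "\<theta> = 1 - q - \<mu>\<^sup>2 / (c * r)\<^sup>2"
  show ?thesis
  proof (rule that[of \<theta>])
    show "0 < \<theta>" using less by (simp add: \<theta>_def)
    fix x :: real assume x: "0 \<le> x"
    define y where "y = x * (c * r)"
    have y: "0 \<le> y" using x cr by (simp add: y_def)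
    define \<Phi> where "\<Phi> = \<delta> - \<beta> * exp y"
    have "D * m * \<kappa> powr (m - 1) * y\<^sup>2 \<le> \<mu>\<^sup>2 * \<Phi>"
      unfolding \<mu>_def \<Phi>_def by (rule mu_k_pos_and_minimal(2)[OF assms(1-5) y])
    then have "D * m * \<kappa> powr (m - 1) * x\<^sup>2 * (c * r)\<^sup>2 \<le> \<mu>\<^sup>2 * \<Phi>"
      by (simp add: y_def power_mult_distrib mult.assoc)
    then have 1: "D * m * \<kappa> powr (m - 1) * x\<^sup>2 \<le> \<mu>\<^sup>2 / (c * r)\<^sup>2 * \<Phi>"
      unfolding times_divide_eq_left using cr by (subst pos_le_divide_eq) auto
    have "y \<le> exp y" using exp_ge_add_one_self[of y] by linarith
    then have "\<beta> * exp y \<le> \<beta> * y" by (rule mult_left_mono_neg) (use assms in simp)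
    then have "\<bar>\<beta>\<bar> * y \<le> \<Phi>"
      using assms(2) unfolding \<Phi>_def abs_of_neg[OF assms(1)] mult_minus_left by linarith
    then have "q * (\<bar>\<beta>\<bar> * y) \<le> q * \<Phi>" using q by simp
    moreover have "q * (\<bar>\<beta>\<bar> * y) = c * x" using assms by (simp add: q_def y_def)
    ultimately have 2: "c * x \<le> q * \<Phi>" by simp
    have "D * m * \<kappa> powr (m - 1) * x\<^sup>2 + c * x \<le> (1 - \<theta>) * \<Phi>"
      using add_mono[OF 1 2] by (simp add: \<theta>_def algebra_simps)
    then show "D * m * \<kappa> powr (m - 1) * x\<^sup>2 + c * x \<le> (1 - \<theta>) * (\<delta> + (- \<beta>) * exp (x * (c * r)))"
      by (simp add: \<Phi>_def y_def)
  qed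
qed

section \<open>Convergence to the equilibrium\<close>

lemma antimono_bounded_below_convergent:
  fixes f :: "real \<Rightarrow> real"
  assumes anti: "\<And>s t. T \<le> s \<Longrightarrow> s \<le> t \<Longrightarrow> f t \<le> f s"
    and lower: "\<And>t. T \<le> t \<Longrightarrow> B \<le> f t"
  shows "\<exists>l\<ge>B. (f \<longlongrightarrow> l) at_top"
proof -
  define l where "l = Inf (f ` {T..})"
  have bdd: "bdd_below (f ` {T..})" using lower by (intro bdd_belowI2[of _ B]) auto
  have l: "l \<le> f t" if "T \<le> t" for t
    unfolding l_def using that by (intro cInf_lower bdd) auto
  have "(f \<longlongrightarrow> l) at_top"
  proof (rule decreasing_tendsto)
    show "\<forall>\<^sub>F t in at_top. l \<le> f t"
      using l unfolding eventually_at_top_linorder by blast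
    fix x assume "l < x"
    then obtain s where "T \<le> s" "f s < x"
      unfolding l_def by (subst (asm) cInf_less_iff[OF _ bdd]) auto
    then show "\<forall>\<^sub>F t in at_top. f t < x"
      using anti unfolding eventually_at_top_linorder by (meson order_le_less_trans)
  qed
  moreover have "B \<le> l" unfolding l_def using lower by (intro cInf_greatest) auto
  ultimately show ?thesis by blast
qed

lemma DERIV_ge_imp_linear_growth:
  fixes f :: "real \<Rightarrow> real"
  assumes "\<And>t. T \<le> t \<Longrightarrow> (f has_real_derivative f' t) (at t)" "\<And>t. T \<le> t \<Longrightarrow> e \<le> f' t" "T \<le> t"
  shows "f T + e * (t - T) \<le> f t"
proof -
  have "f T - e * T \<le> f t - e * t"
    by (rule DERIV_nonneg_imp_nondecreasing[OF assms(3), where f = "\<lambda>t. f t - e * t"])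
       (use assms(1,2) in \<open>force intro!: derivative_eq_intros exI\<close>)
  then show ?thesis by (simp add: algebra_simps)
qed

lemma bounded_imp_not_eventually_DERIV_ge:
  fixes f :: "real \<Rightarrow> real"
  assumes "\<forall>\<^sub>F t in at_top. (f has_real_derivative f' t) (at t)" and "\<And>t. \<bar>f t\<bar> \<le> B"
    and "\<forall>\<^sub>F t in at_top. e \<le> f' t" "0 < e"
  shows False
proof -
  have "\<forall>\<^sub>F t in at_top. (f has_real_derivative f' t) (at t) \<and> e \<le> f' t"
    using assms by (intro eventually_conj)
  then obtain T where T: "\<And>t. T \<le> t \<Longrightarrow> (f has_real_derivative f' t) (at t)" "\<And>t. T \<le> t \<Longrightarrow> e \<le> f' t"
    unfolding eventually_at_top_linorder by blast
  have "0 \<le> B" using assms(2)[of T] by linarith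
  then have "f T + e * (T + (2 * B + 1) / e - T) \<le> f (T + (2 * B + 1) / e)"
    using assms(4) by (intro DERIV_ge_imp_linear_growth[OF T]) auto
  then have "f T + (2 * B + 1) \<le> f (T + (2 * B + 1) / e)" using assms(4) by simp
  then show False using assms(2)[of T] assms(2)[of "T + (2 * B + 1) / e"] by linarith
qed

text \<open>A positive limit of \<open>K\<close> makes \<open>H\<close> grow linearly; with
  \<open>w\<close> bounded, the derivative \<open>w - H\<close> then drives \<open>g\<close> below
  any bound.\<close>

lemma bounded_forced_limit_nonpos:
  fixes g w H :: "real \<Rightarrow> real"
  assumes g: "\<And>t. (g has_real_derivative w t - H t) (at t)" and H: "\<And>t. (H has_real_derivative K t) (at t)"
    and bdd: "\<And>t. \<bar>g t\<bar> \<le> B" "\<And>t. \<bar>w t\<bar> \<le> B" and lim: "(K \<longlongrightarrow> k) at_top"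
  shows "k \<le> 0"
proof (rule ccontr)
  assume "\<not> k \<le> 0"
  then have k: "0 < k" by simp
  then have "\<forall>\<^sub>F t in at_top. k / 2 < K t" using lim by (intro order_tendstoD(1)) auto
  then obtain T where T: "\<And>t. T \<le> t \<Longrightarrow> k / 2 \<le> K t"
    unfolding eventually_at_top_linorder by (meson less_imp_le)
  have growth: "H T + k / 2 * (t - T) \<le> H t" if "T \<le> t" for t
    by (rule DERIV_ge_imp_linear_growth[OF H T that])
  define S where "S = max T (T + (B + 1 - H T) / (k / 2))"
  have "1 \<le> - (w t - H t)" if t: "S \<le> t" for t
  proof -
    have "(B + 1 - H T) / (k / 2) \<le> t - T" using t by (simp add: S_def)
    then have "B + 1 - H T \<le> k / 2 * (t - T)" using k by (simp add: pos_divide_le_eq mult.commute)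
    moreover have "T \<le> t" using t by (simp add: S_def)
    ultimately show ?thesis using growth[of t] bdd(2)[of t] by linarith
  qed
  then have "\<forall>\<^sub>F t in at_top. 1 \<le> - (w t - H t)" unfolding eventually_at_top_linorder by blast
  moreover have "\<forall>\<^sub>F t in at_top. ((\<lambda>t. - g t) has_real_derivative - (w t - H t)) (at t)"
    using g by (intro always_eventually allI DERIV_minus)
  moreover have "\<bar>- g t\<bar> \<le> B" for t using bdd by simp
  ultimately show False
    using bounded_imp_not_eventually_DERIV_ge[of "\<lambda>t. - g t" "\<lambda>t. - (w t - H t)" B 1] by simp
qed

lemma bounded_forced_limit_zero:
  fixes g w H :: "real \<Rightarrow> real"
  assumes g: "\<And>t. (g has_real_derivative w t - H t) (at t)" and H: "\<And>t. (H has_real_derivative K t) (at t)"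
    and bdd: "\<And>t. \<bar>g t\<bar> \<le> B" "\<And>t. \<bar>w t\<bar> \<le> B" and lim: "(K \<longlongrightarrow> k) at_top"
  shows "k = 0"
proof -
  have "((\<lambda>t. - g t) has_real_derivative - w t - - H t) (at t)" for t
    by (rule derivative_eq_intros g refl | simp)+
  moreover have "((\<lambda>t. - H t) has_real_derivative - K t) (at t)" for t by (intro DERIV_minus H)
  ultimately have "- k \<le> 0"
    using bdd tendsto_minus[OF lim]
    by (intro bounded_forced_limit_nonpos[where g = "\<lambda>t. - g t" and w = "\<lambda>t. - w t" and H = "\<lambda>t. - H t"]) auto
  then show ?thesis using bounded_forced_limit_nonpos[OF g H bdd lim] by simp
qed

text \<open>A negative value of \<open>Y\<close> persists by monotonicity, and so does a positive
  limit; since \<open>w\<close> tends to 0, either would keep the derivative of the bounded function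
  \<open>g\<close> away from 0 with a fixed sign.\<close>

lemma antimono_forcing_tendsto_0:
  fixes g w Y :: "real \<Rightarrow> real"
  assumes g: "\<And>t. (g has_real_derivative (w t - Y t) / A) (at t)" and A: "0 < A"
    and bdd: "\<And>t. \<bar>g t\<bar> \<le> B" and w: "(w \<longlongrightarrow> 0) at_top"
    and anti: "\<And>s t. T \<le> s \<Longrightarrow> s \<le> t \<Longrightarrow> Y t \<le> Y s"
  shows "(Y \<longlongrightarrow> 0) at_top"
proof -
  have nonneg: "0 \<le> Y s" if s: "T \<le> s" for s
  proof (rule ccontr)
    assume neg: "\<not> 0 \<le> Y s"
    have "\<forall>\<^sub>F t in at_top. Y s / 2 < w t" using neg w by (intro order_tendstoD(1)) auto
    then have "\<forall>\<^sub>F t in at_top. - Y s / 2 / A \<le> (w t - Y t) / A"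
      using eventually_ge_at_top[of s]
    proof eventually_elim
      case (elim t)
      then have "Y t \<le> Y s" using anti s by simp
      then show ?case using elim A by (intro divide_right_mono) auto
    qed
    then show False
      using bounded_imp_not_eventually_DERIV_ge[of g "\<lambda>t. (w t - Y t) / A" B "- Y s / 2 / A"] g bdd neg A
      by (simp add: divide_pos_pos divide_neg_pos)
  qed
  obtain l where l: "(Y \<longlongrightarrow> l) at_top" "0 \<le> l"
    using antimono_bounded_below_convergent[where f = Y and T = T and B = 0, OF anti nonneg] by blast
  have "l = 0"
  proof (rule ccontr)
    assume "l \<noteq> 0"
    then have "0 < l" using l by simp
    have "((\<lambda>t. - ((w t - Y t) / A)) \<longlongrightarrow> - ((0 - l) / A)) at_top"
      by (intro tendsto_intros w l) (use A in simp)
    then have "\<forall>\<^sub>F t in at_top. l / A / 2 < - ((w t - Y t) / A)"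
      using \<open>0 < l\<close> A by (intro order_tendstoD(1)) (auto simp: field_simps)
    then have "\<forall>\<^sub>F t in at_top. l / A / 2 \<le> - ((w t - Y t) / A)"
      by eventually_elim simp
    moreover have "\<forall>\<^sub>F t in at_top. ((\<lambda>t. - g t) has_real_derivative - ((w t - Y t) / A)) (at t)"
      using g by (intro always_eventually allI DERIV_minus)
    moreover have "\<bar>- g t\<bar> \<le> B" for t using bdd by simp
    ultimately show False
      using bounded_imp_not_eventually_DERIV_ge[of "\<lambda>t. - g t" "\<lambda>t. - ((w t - Y t) / A)" B "l / A / 2"] \<open>0 < l\<close> A by simp
  qed
  then show ?thesis using l by simp
qed

section \<open>Consequences of the standing assumptions\<close>

lemma standing_assmsD:
  assumes "standing_assms \<kappa> b b' d d' d''"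
  shows "0 < \<kappa>" "b \<kappa> = d \<kappa>" "continuous_on {0..} b" "continuous_on {0..} d"
    and "0 < s \<Longrightarrow> (b has_real_derivative b' s) (at s)"
    and "0 < s \<Longrightarrow> (d has_real_derivative d' s) (at s)" "0 < s \<Longrightarrow> 0 < d' s"
    and "0 < s \<Longrightarrow> s < \<kappa> \<Longrightarrow> d s < b s"
    and "\<exists>sM>0. {s. 0 < s \<and> loc_ext_pt b s} = {sM} \<and> (\<forall>s\<ge>0. b s \<le> b sM) \<and> sM < \<kappa>"
proof -
  note A = assms[unfolded standing_assms_def]
  have within: "(b has_real_derivative b' s) (at s within {0..})"
    "(d has_real_derivative d' s) (at s within {0..})" if "0 \<le> s" for s
    using A that by simp_all
  show "continuous_on {0..} b" "continuous_on {0..} d"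
    using within by (auto intro: DERIV_continuous_on)
  have "at s within {0..} = at s" if "0 < s" using that by (intro at_within_interior) simp
  then show "0 < s \<Longrightarrow> (b has_real_derivative b' s) (at s)" "0 < s \<Longrightarrow> (d has_real_derivative d' s) (at s)"
    using within[of s] by simp_all
  show "\<exists>sM>0. {s. 0 < s \<and> loc_ext_pt b s} = {sM} \<and> (\<forall>s\<ge>0. b s \<le> b sM) \<and> sM < \<kappa>"
    using A by (elim conjE)
qed (use assms[unfolded standing_assms_def] in simp_all)

text \<open>Below \<open>\<kappa>\<close>, \<open>d s < b s\<close> excludes another equilibrium.
  Above it, strict growth of \<open>d\<close> forces \<open>b \<kappa> < b L\<close>; as
  \<open>b\<close> is maximal at \<open>sM < \<kappa>\<close>, it would have an interior minimum
  between \<open>sM\<close> and \<open>L\<close>, a second positive local extremum.\<close>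

lemma standing_assms_equilibrium_unique:
  assumes st: "standing_assms \<kappa> b b' d d' d''" and "0 < L" "b L = d L"
  shows "L = \<kappa>"
proof (rule ccontr)
  assume "L \<noteq> \<kappa>"
  note \<kappa> = standing_assmsD(1,2)[OF st]
  have L: "\<kappa> < L" using standing_assmsD(8)[OF st, of L] \<open>L \<noteq> \<kappa>\<close> assms(2,3) by linarith
  obtain sM where sM: "0 < sM" "{s. 0 < s \<and> loc_ext_pt b s} = {sM}" "\<And>s. 0 \<le> s \<Longrightarrow> b s \<le> b sM" "sM < \<kappa>"
    using standing_assmsD(9)[OF st] by auto
  have "d \<kappa> < d L"
  proof (rule DERIV_pos_imp_increasing[OF L])
    fix s assume "\<kappa> \<le> s"
    then have "0 < s" using \<kappa> by simp
    then show "\<exists>y. (d has_real_derivative y) (at s) \<and> 0 < y"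
      using standing_assmsD(6,7)[OF st] by blast
  qed
  then have bL: "b \<kappa> < b L" using \<kappa> assms by simp
  obtain x where x: "x \<in> {sM..L}" "\<And>y. y \<in> {sM..L} \<Longrightarrow> b x \<le> b y"
    using continuous_attains_inf[of "{sM..L}" b] continuous_on_subset[OF standing_assmsD(3)[OF st], of "{sM..L}"] sM L by auto
  have bx: "b x \<le> b \<kappa>" using x(2)[of \<kappa>] sM L by simp
  then have "x \<noteq> L" "x \<noteq> sM" using bL sM(3)[of L] assms by auto
  then have xin: "sM < x" "x < L" using x(1) by auto
  have "loc_ext_pt b x"
    unfolding loc_ext_pt_def
    by (rule exI[of _ "min (x - sM) (L - x)"]) (use xin x(2) in \<open>auto simp: abs_less_iff\<close>)
  then have "x \<in> {s. 0 < s \<and> loc_ext_pt b s}" using xin sM(1) by simp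
  then have "x = sM" unfolding sM(2) by simp
  then show False using xin by simp
qed

section \<open>Monotone approach to the equilibrium\<close>

text \<open>The constant state propagates backwards: on a half-line where \<open>\<phi>\<close>
  equals \<open>\<kappa>\<close>, the equation forces
  \<open>b (\<phi> (t - h)) = b \<kappa>\<close>, and \<open>\<beta> \<noteq> 0\<close> makes
  \<open>\<kappa>\<close> an isolated solution of this, so by continuity \<open>\<phi>\<close>
  equals \<open>\<kappa>\<close> a little further left. The limit 0 at minus infinity gives the
  constant state a leftmost start \<open>T0\<close>, a contradiction.\<close>

lemma wave_profile_not_eventually_const:
  fixes \<phi> :: "real \<Rightarrow> real"
  assumes cont: "continuous_on UNIV \<phi>" and lim: "(\<phi> \<longlongrightarrow> 0) at_bot" and "0 < \<kappa>" "0 < h"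
    and b': "(b has_real_derivative \<beta>) (at \<kappa>)" "\<beta> \<noteq> 0" "b \<kappa> = d \<kappa>"
    and H: "\<And>t. (H has_real_derivative b (\<phi> (t - h)) - d (\<phi> t)) (at t)"
    and g: "\<And>t. ((\<lambda>t. D * \<phi> t powr m) has_real_derivative c * \<phi> t - H t) (at t)"
    and const: "\<And>t. T \<le> t \<Longrightarrow> \<phi> t = \<kappa>"
  shows False
proof -
  have local_const_deriv: "f' = 0" if "(f has_real_derivative f') (at t)" "S < t" "\<And>u. S < u \<Longrightarrow> f u = k"
    for f :: "real \<Rightarrow> real" and f' t S k
  proof -
    have "((\<lambda>_. k) has_real_derivative f') (at t)"
      by (rule has_field_derivative_transform_within_open[OF that(1), of "{S<..}"]) (use that in auto)
    then show ?thesis using DERIV_unique DERIV_const by blast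
  qed
  define S where "S = {t. \<forall>u\<ge>t. \<phi> u = \<kappa>}"
  have "\<forall>\<^sub>F t in at_bot. \<phi> t < \<kappa>" using lim \<open>0 < \<kappa>\<close> by (rule order_tendstoD(2))
  then obtain N where N: "\<And>t. t \<le> N \<Longrightarrow> \<phi> t < \<kappa>" unfolding eventually_at_bot_linorder by blast
  have bdd: "bdd_below S"
  proof (rule bdd_belowI[of _ N])
    fix t assume "t \<in> S"
    then show "N \<le> t" using N[of t] by (force simp: S_def)
  qed
  have "T \<in> S" using const by (simp add: S_def)
  define T0 where "T0 = Inf S"
  have eq: "\<phi> u = \<kappa>" if u: "T0 < u" for u
  proof -
    obtain t where "t \<in> S" "t < u"
      using u \<open>T \<in> S\<close> cInf_less_iff[OF _ bdd, of u] unfolding T0_def by auto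
    then show ?thesis by (simp add: S_def)
  qed
  have "H u = c * \<kappa>" if "T0 < u" for u
  proof -
    have "c * \<phi> u - H u = 0"
      by (rule local_const_deriv[OF g that]) (use eq in auto)
    then show ?thesis using eq[OF that] by simp
  qed
  then have K0: "b (\<phi> (u - h)) - d (\<phi> u) = 0" if "T0 < u" for u
    by (rule local_const_deriv[OF H that])
  have contT0: "isCont \<phi> T0" using cont by (simp add: continuous_on_eq_continuous_at)
  have "((\<lambda>u. \<phi> u) \<longlongrightarrow> \<phi> T0) (at_right T0)"
    using contT0 unfolding isCont_def by (rule tendsto_mono[rotated]) (simp add: at_le)
  moreover have "((\<lambda>u. \<phi> u) \<longlongrightarrow> \<kappa>) (at_right T0)"
    by (rule Lim_transform_eventually[OF tendsto_const[of \<kappa>]])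
       (auto simp: eventually_at_filter eq)
  ultimately have \<phi>T0: "\<phi> T0 = \<kappa>" using tendsto_unique[OF trivial_limit_at_right_real] by blast
  \<comment> \<open>Caratheodory's form of the derivative: \<open>G\<close> is the slope function of
    \<open>b\<close> at \<open>\<kappa>\<close>, and it stays nonzero along \<open>\<phi>\<close>
    near \<open>T0\<close>.\<close>
  obtain G where G: "\<And>z. b z - b \<kappa> = G z * (z - \<kappa>)" "isCont G \<kappa>" "G \<kappa> = \<beta>"
    using b'(1) CARAT_DERIV[of b \<beta> \<kappa>] by auto
  have "isCont (\<lambda>u. G (\<phi> u)) T0" using isCont_o2[OF contT0, of G] G(2) \<phi>T0 by simp
  then have "((\<lambda>u. G (\<phi> u)) \<longlongrightarrow> \<beta>) (at T0)" using \<phi>T0 G(3) by (simp add: isCont_def)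
  then have "\<forall>\<^sub>F u in at T0. G (\<phi> u) \<noteq> 0" using b'(2) by (rule tendsto_imp_eventually_ne)
  then obtain e where e: "0 < e" "\<And>u. u \<noteq> T0 \<Longrightarrow> \<bar>u - T0\<bar> < e \<Longrightarrow> G (\<phi> u) \<noteq> 0"
    unfolding eventually_at dist_real_def by blast
  \<comment> \<open>The step to the left is short enough for \<open>G (\<phi> u) \<noteq> 0\<close>
    and, being at most \<open>h / 2\<close>, for \<open>u + h\<close> to lie in the constant
    region.\<close>
  have "\<phi> u = \<kappa>" if u: "T0 - min e h / 2 \<le> u" for u
  proof (cases "T0 \<le> u")
    case True
    then show ?thesis using eq \<phi>T0 by (cases "u = T0") auto
  next
    case False
    have "T0 < u + h" "\<bar>u - T0\<bar> < e" using u False e(1) \<open>0 < h\<close> by (auto simp: min_def split: if_splits)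
    then have "b (\<phi> u) = b \<kappa>" "G (\<phi> u) \<noteq> 0"
      using K0[of "u + h"] eq[of "u + h"] b'(3) e(2)[of u] False by auto
    then show ?thesis using G(1)[of "\<phi> u"] by simp
  qed
  then have "T0 - min e h / 2 \<in> S" by (simp add: S_def)
  then have "T0 \<le> T0 - min e h / 2" unfolding T0_def by (rule cInf_lower[OF _ bdd])
  then show False using e(1) \<open>0 < h\<close> by (simp add: min_def split: if_splits)
qed

text \<open>\<open>\<sigma> = 1\<close> stands for a monotone approach from above,
  \<open>\<sigma> = -1\<close> for one from below. The signed deviation \<open>v\<close> of
  \<open>\<phi>\<close> and the normalized deviation \<open>V\<close> of its power agree to first
  order, and \<open>V\<close> is of the kind excluded by
  \<open>no_positive_decaying_solution\<close>.\<close>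

lemma no_strict_monotone_approach:
  fixes \<phi> :: "real \<Rightarrow> real"
  assumes pos: "1 < m" "0 < D" "0 < \<kappa>" "0 < c" "0 < h" "0 < \<delta>" "\<beta> < 0" "0 < \<theta>"
    and char: "\<And>x. 0 \<le> x \<Longrightarrow>
      D * m * \<kappa> powr (m - 1) * x\<^sup>2 + c * x \<le> (1 - \<theta>) * (\<delta> + (- \<beta>) * exp (x * h))"
    and b': "(b has_real_derivative \<beta>) (at \<kappa>)" and d': "(d has_real_derivative \<delta>) (at \<kappa>)"
    and bd: "b \<kappa> = d \<kappa>"
    and H: "\<And>t. (H has_real_derivative b (\<phi> (t - h)) - d (\<phi> t)) (at t)"
    and g: "\<And>t. ((\<lambda>t. D * \<phi> t powr m) has_real_derivative c * \<phi> t - H t) (at t)"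
    and nonneg: "\<And>t. 0 \<le> \<phi> t" and bdd: "\<And>t. \<bar>D * \<phi> t powr m\<bar> \<le> B"
    and lim: "(\<phi> \<longlongrightarrow> \<kappa>) at_top"
    and \<sigma>: "\<sigma> = 1 \<or> \<sigma> = -1" and strict: "\<And>t. T \<le> t \<Longrightarrow> \<sigma> * \<kappa> < \<sigma> * \<phi> t"
    and anti: "\<And>s t. T \<le> s \<Longrightarrow> s \<le> t \<Longrightarrow> \<sigma> * \<phi> t \<le> \<sigma> * \<phi> s"
  shows False
proof -
  define A where "A = D * m * \<kappa> powr (m - 1)"
  have A: "0 < A" using pos by (simp add: A_def)
  define v where "v t = \<sigma> * (\<phi> t - \<kappa>)" for t
  \<comment> \<open>\<open>A\<close> is the derivative of \<open>D * z powr m\<close> at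
    \<open>z = \<kappa>\<close>, hence the division; \<open>V\<close> inherits its differentiability
    from the power of \<open>\<phi>\<close>.\<close>
  define V where "V t = \<sigma> * (D * \<phi> t powr m - D * \<kappa> powr m) / A" for t
  define Y where "Y t = \<sigma> * (H t - c * \<kappa>)" for t
  define K where "K t = - (\<sigma> * (b (\<phi> (t - h)) - d (\<phi> t)))" for t
  have V': "(V has_real_derivative (c * v t - Y t) / A) (at t)" for t
  proof -
    have "(V has_real_derivative \<sigma> * (c * \<phi> t - H t - 0) / A) (at t)"
      unfolding V_def by (intro DERIV_cdivide DERIV_cmult DERIV_diff g DERIV_const)
    then show ?thesis by (simp add: v_def Y_def algebra_simps)
  qed
  have Y': "(Y has_real_derivative - K t) (at t)" for t
  proof -
    have "(Y has_real_derivative \<sigma> * (b (\<phi> (t - h)) - d (\<phi> t) - 0)) (at t)"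
      unfolding Y_def by (intro DERIV_cmult DERIV_diff H DERIV_const)
    then show ?thesis by (simp add: K_def)
  qed
  have shift: "filterlim (\<lambda>t. t - h) at_top (at_top :: real filter)"
    using filterlim_tendsto_add_at_top[OF tendsto_const[of "- h"] filterlim_ident]
    by (simp add: algebra_simps)

  have "((\<lambda>z. z powr m) has_real_derivative m * \<kappa> powr (m - 1)) (at \<kappa>)"
    using pos by (intro has_real_derivative_powr) simp
  then obtain P where P: "\<And>z. z powr m - \<kappa> powr m = P z * (z - \<kappa>)" "isCont P \<kappa>" "P \<kappa> = m * \<kappa> powr (m - 1)"
    using CARAT_DERIV[of "\<lambda>z. z powr m"] by auto
  obtain Q where Q: "\<And>z. d z - d \<kappa> = Q z * (z - \<kappa>)" "isCont Q \<kappa>" "Q \<kappa> = \<delta>"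
    using d' CARAT_DERIV[of d] by auto
  obtain R where R: "\<And>z. b z - b \<kappa> = R z * (z - \<kappa>)" "isCont R \<kappa>" "R \<kappa> = \<beta>"
    using b' CARAT_DERIV[of b] by auto
  define \<rho> where "\<rho> t = D * P (\<phi> t) / A" for t
  have V_eq: "V t = \<rho> t * v t" for t
  proof -
    have "V t = \<sigma> * (D * (\<phi> t powr m - \<kappa> powr m)) / A" by (simp add: V_def right_diff_distrib)
    then show ?thesis unfolding P(1) \<rho>_def v_def by simp
  qed
  have "(\<rho> \<longlongrightarrow> D * P \<kappa> / A) at_top"
    unfolding \<rho>_def using A by (intro tendsto_intros isCont_tendsto_compose[OF P(2) lim]) simp
  then have \<rho>: "(\<rho> \<longlongrightarrow> 1) at_top" using A pos by (simp add: P(3) A_def mult.assoc)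
  then have \<rho>_ev: "\<forall>\<^sub>F t in at_top. 0 < \<rho> t" by (rule order_tendstoD) simp

  have V_pos: "0 < V t" if "T \<le> t" for t
  proof (cases "\<sigma> = 1")
    case True
    then have "\<kappa> powr m < \<phi> t powr m" using strict[OF that] pos by (intro powr_less_mono2) auto
    then show ?thesis using True pos A by (simp add: V_def)
  next
    case False
    then have "\<phi> t powr m < \<kappa> powr m" using strict[OF that] \<sigma> pos nonneg by (intro powr_less_mono2) auto
    then show ?thesis using False \<sigma> pos A by (simp add: V_def divide_neg_pos)
  qed
  have V_anti: "V t \<le> V s" if "T \<le> s" "s \<le> t" for s t
  proof (cases "\<sigma> = 1")
    case True
    then have "\<phi> t powr m \<le> \<phi> s powr m" using anti[OF that] pos nonneg by (intro powr_mono2) auto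
    then show ?thesis using True pos A by (simp add: V_def divide_right_mono)
  next
    case False
    then have "\<phi> s powr m \<le> \<phi> t powr m" using anti[OF that] \<sigma> pos nonneg by (intro powr_mono2) auto
    then show ?thesis using False \<sigma> pos A by (auto simp: V_def divide_right_mono)
  qed
  have v_lim: "(v \<longlongrightarrow> 0) at_top"
  proof -
    have "(v \<longlongrightarrow> \<sigma> * (\<kappa> - \<kappa>)) at_top" unfolding v_def by (intro tendsto_intros lim)
    then show ?thesis by simp
  qed
  have V_lim: "(V \<longlongrightarrow> 0) at_top"
    using tendsto_mult[OF \<rho> v_lim] by (simp add: V_eq[abs_def])
  have v_close: "\<forall>\<^sub>F t in at_top. (1 - \<epsilon>) * V t \<le> v t \<and> v t \<le> (1 + \<epsilon>) * V t" if "0 < \<epsilon>" for \<epsilon>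
  proof -
    have "((\<lambda>t. 1 / \<rho> t) \<longlongrightarrow> 1 / 1) at_top" by (intro tendsto_intros \<rho>) simp
    then have "\<forall>\<^sub>F t in at_top. 1 - \<epsilon> < 1 / \<rho> t" "\<forall>\<^sub>F t in at_top. 1 / \<rho> t < 1 + \<epsilon>"
      using that by (auto intro: order_tendstoD)
    then show ?thesis
      using \<rho>_ev eventually_ge_at_top[of T]
    proof eventually_elim
      case (elim t)
      have "v t = 1 / \<rho> t * V t" using elim by (simp add: V_eq)
      moreover have "(1 - \<epsilon>) * V t \<le> 1 / \<rho> t * V t" "1 / \<rho> t * V t \<le> (1 + \<epsilon>) * V t"
        using elim V_pos[of t] by (intro mult_right_mono; simp)+
      ultimately show ?case by linarith
    qed
  qed
  have K_close: "\<forall>\<^sub>F t in at_top. (1 - \<epsilon>) * (\<delta> * V t + (- \<beta>) * V (t - h)) \<le> K t" if "0 < \<epsilon>" for \<epsilon>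
  proof -
    have "((\<lambda>t. Q (\<phi> t) / \<rho> t) \<longlongrightarrow> \<delta> / 1) at_top"
      using isCont_tendsto_compose[OF Q(2) lim] Q(3) by (intro tendsto_divide \<rho>) auto
    then have evQ: "\<forall>\<^sub>F t in at_top. (1 - \<epsilon>) * \<delta> < Q (\<phi> t) / \<rho> t"
      using that pos by (intro order_tendstoD(1)) (auto simp: algebra_simps)
    have "((\<lambda>t. - R (\<phi> t) / \<rho> t) \<longlongrightarrow> - \<beta> / 1) at_top"
      using isCont_tendsto_compose[OF R(2) lim] R(3) by (intro tendsto_divide tendsto_minus \<rho>) auto
    then have "\<forall>\<^sub>F t in at_top. (1 - \<epsilon>) * (- \<beta>) < - R (\<phi> t) / \<rho> t"
      using that pos by (intro order_tendstoD(1)) (auto simp: algebra_simps mult_neg_pos)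
    then have "\<forall>\<^sub>F t in at_top. (1 - \<epsilon>) * (- \<beta>) < - R (\<phi> t) / \<rho> t \<and> 0 < \<rho> t \<and> T \<le> t"
      using \<rho>_ev eventually_ge_at_top[of T] by eventually_elim simp
    then have evR: "\<forall>\<^sub>F t in at_top. (1 - \<epsilon>) * (- \<beta>) < - R (\<phi> (t - h)) / \<rho> (t - h) \<and> 0 < \<rho> (t - h) \<and> T \<le> t - h"
      using shift by (rule eventually_compose_filterlim)
    show ?thesis
      using evQ evR \<rho>_ev
    proof eventually_elim
      case (elim t)
      then have T: "T \<le> t" "T \<le> t - h" using pos by auto
      have "\<sigma> * (d (\<phi> t) - d \<kappa>) = Q (\<phi> t) / \<rho> t * V t"
        unfolding Q(1) V_eq v_def using elim by simp
      moreover have "(1 - \<epsilon>) * \<delta> * V t \<le> Q (\<phi> t) / \<rho> t * V t"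
        using elim V_pos[OF T(1)] by (intro mult_right_mono) auto
      moreover have "- (\<sigma> * (b (\<phi> (t - h)) - b \<kappa>)) = - R (\<phi> (t - h)) / \<rho> (t - h) * V (t - h)"
        unfolding R(1) V_eq v_def using elim by simp
      moreover have "(1 - \<epsilon>) * (- \<beta>) * V (t - h) \<le> - R (\<phi> (t - h)) / \<rho> (t - h) * V (t - h)"
        using elim V_pos[OF T(2)] by (intro mult_right_mono) auto
      moreover have "K t = \<sigma> * (d (\<phi> t) - d \<kappa>) + - (\<sigma> * (b (\<phi> (t - h)) - b \<kappa>))"
        unfolding K_def bd by (simp add: algebra_simps)
      ultimately have "(1 - \<epsilon>) * \<delta> * V t + (1 - \<epsilon>) * (- \<beta>) * V (t - h) \<le> K t" by linarith
      then show ?case by (simp only: distrib_left mult.assoc)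
    qed
  qed
  \<comment> \<open>With \<open>\<epsilon> = 1\<close> the estimate \<open>K_close\<close> says that
    \<open>K\<close> is eventually nonnegative, so \<open>Y\<close> is eventually
    nonincreasing.\<close>
  have Y_lim: "(Y \<longlongrightarrow> 0) at_top"
  proof -
    have "\<forall>\<^sub>F t in at_top. (1 - 1) * (\<delta> * V t + (- \<beta>) * V (t - h)) \<le> K t" by (rule K_close) simp
    then obtain S where S: "\<And>t. S \<le> t \<Longrightarrow> 0 \<le> K t"
      unfolding eventually_at_top_linorder by auto
    have "Y t \<le> Y s" if "S \<le> s" "s \<le> t" for s t
    proof (rule DERIV_nonpos_imp_nonincreasing[OF that(2)])
      fix x assume "s \<le> x" "x \<le> t"
      then show "\<exists>y. (Y has_real_derivative y) (at x) \<and> y \<le> 0"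
        using Y'[of x] S[of x] that by (intro exI[of _ "- K x"]) auto
    qed
    moreover have "((\<lambda>t. c * v t) \<longlongrightarrow> 0) at_top" using tendsto_mult_right_zero[OF v_lim] .
    moreover have "\<bar>V t\<bar> \<le> (B + \<bar>D * \<kappa> powr m\<bar>) / A" for t
    proof -
      have "\<bar>\<sigma>\<bar> = 1" using \<sigma> by auto
      then have "\<bar>V t\<bar> = \<bar>D * \<phi> t powr m - D * \<kappa> powr m\<bar> / A"
        using A by (simp add: V_def abs_mult)
      also have "\<dots> \<le> (B + \<bar>D * \<kappa> powr m\<bar>) / A"
        using bdd[of t] A by (intro divide_right_mono) auto
      finally show ?thesis .
    qed
    ultimately show ?thesis by (intro antimono_forcing_tendsto_0[OF V' A])
  qed
  show False
    by (rule no_positive_decaying_solution[where A = A and c = c and h = h and \<delta> = \<delta> and \<beta> = "- \<beta>"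
          and \<theta> = \<theta> and V = V and v = v and Y = Y and H = K and S = T])
       (use A pos char V' Y' V_pos V_anti V_lim Y_lim v_close K_close in \<open>auto simp: A_def\<close>)
qed

text \<open>A bounded monotone tail converges to some \<open>L\<close>, positive because of the
  lower limit; the equation forces \<open>b L = d L\<close> and so \<open>L = \<kappa>\<close>. If
  the tail reaches \<open>\<kappa>\<close>, it is constant from there on; otherwise it stays
  strictly on one side. The two preceding lemmas exclude these cases.\<close>

lemma fast_semi_wavefront_not_eventually_monotone:
  assumes "1 < m" "0 < D" "0 < r" and st: "standing_assms \<kappa> b b' d d' d''" and \<beta>: "b' \<kappa> < 0"
    and sw: "semi_wavefront D m r \<kappa> b d c \<phi>" and speed: "c_kappa D m \<kappa> r (b' \<kappa>) (d' \<kappa>) < ereal c"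
  shows "\<not> eventually_monotone \<phi>"
proof
  assume "eventually_monotone \<phi>"
  note \<kappa> = standing_assmsD(1)[OF st] and \<delta> = standing_assmsD(7)[OF st standing_assmsD(1)[OF st]]
  have c: "0 < c" and nonneg: "\<And>t. 0 \<le> \<phi> t" and cont: "continuous_on UNIV \<phi>"
    and bdd: "bounded (range \<phi>)" and weak: "wave_profile_distr D m r b d c \<phi>"
    and at_bot: "(\<phi> \<longlongrightarrow> 0) at_bot" and liminf: "0 < Liminf at_top (\<lambda>t. ereal (\<phi> t))"
    using sw unfolding semi_wavefront_def by simp_all
  have h: "0 < c * r" using c assms by simp
  obtain H where H: "\<And>t. (H has_real_derivative b (\<phi> (t - c * r)) - d (\<phi> t)) (at t)"
    and g: "\<And>t. ((\<lambda>t. D * \<phi> t powr m) has_real_derivative c * \<phi> t - H t) (at t)"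
    using wave_profile_classical[OF assms(1) cont nonneg standing_assmsD(3,4)[OF st] weak] by blast
  obtain M where M: "\<And>t. \<phi> t \<le> M"
    using bdd nonneg unfolding bounded_iff by (auto simp: abs_of_nonneg)
  define B where "B = max (D * M powr m) (c * M)"
  have bddg: "\<bar>D * \<phi> t powr m\<bar> \<le> B" for t
  proof -
    have "D * \<phi> t powr m \<le> D * M powr m"
      using assms nonneg M by (intro mult_left_mono powr_mono2) auto
    moreover have "\<bar>D * \<phi> t powr m\<bar> = D * \<phi> t powr m" using assms(2) by simp
    ultimately show ?thesis unfolding B_def by linarith
  qed
  have bddw: "\<bar>c * \<phi> t\<bar> \<le> B" for t
  proof -
    have "c * \<phi> t \<le> c * M" using c M by simp
    moreover have "\<bar>c * \<phi> t\<bar> = c * \<phi> t" using c nonneg by simp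
    ultimately show ?thesis unfolding B_def by linarith
  qed
  \<comment> \<open>The sign unifies the two kinds of monotonicity:
    \<open>\<sigma> * \<phi> t\<close> is nonincreasing on the tail in either case.\<close>
  obtain \<sigma> T :: real where \<sigma>: "\<sigma> = 1 \<or> \<sigma> = -1"
    and anti: "\<And>s t. T \<le> s \<Longrightarrow> s \<le> t \<Longrightarrow> \<sigma> * \<phi> t \<le> \<sigma> * \<phi> s"
  proof -
    obtain T where "(\<forall>x y. T \<le> x \<longrightarrow> x \<le> y \<longrightarrow> \<phi> x \<le> \<phi> y) \<or> (\<forall>x y. T \<le> x \<longrightarrow> x \<le> y \<longrightarrow> \<phi> y \<le> \<phi> x)"
      using \<open>eventually_monotone \<phi>\<close> unfolding eventually_monotone_def by blast
    then show thesis using that[of "-1" T] that[of 1 T] by auto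
  qed
  have "- \<bar>M\<bar> \<le> \<sigma> * \<phi> t" for t using \<sigma> nonneg[of t] M[of t] by auto
  then obtain l where l: "((\<lambda>t. \<sigma> * \<phi> t) \<longlongrightarrow> l) at_top"
    using antimono_bounded_below_convergent[where f = "\<lambda>t. \<sigma> * \<phi> t" and T = T and B = "- \<bar>M\<bar>", OF anti] by blast
  define L where "L = \<sigma> * l"
  have "((\<lambda>t. \<sigma> * (\<sigma> * \<phi> t)) \<longlongrightarrow> L) at_top" unfolding L_def by (intro tendsto_intros l)
  moreover have "\<sigma> * (\<sigma> * x) = x" for x using \<sigma> by auto
  ultimately have lim: "(\<phi> \<longlongrightarrow> L) at_top" by simp
  have "Liminf at_top (\<lambda>t. ereal (\<phi> t)) = ereal L"
    using lim by (intro lim_imp_Liminf) auto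
  then have "0 < L" using liminf by simp
  have "filterlim (\<lambda>t. t - c * r) at_top (at_top :: real filter)"
    using filterlim_tendsto_add_at_top[OF tendsto_const[of "- (c * r)"] filterlim_ident]
    by (simp add: algebra_simps)
  then have "((\<lambda>t. \<phi> (t - c * r)) \<longlongrightarrow> L) at_top" by (rule filterlim_compose[OF lim])
  then have "((\<lambda>t. b (\<phi> (t - c * r)) - d (\<phi> t)) \<longlongrightarrow> b L - d L) at_top"
    using DERIV_isCont[OF standing_assmsD(5)[OF st \<open>0 < L\<close>]] DERIV_isCont[OF standing_assmsD(6)[OF st \<open>0 < L\<close>]] lim
    by (intro tendsto_diff isCont_tendsto_compose[of L b] isCont_tendsto_compose[of L d])
  then have "b L - d L = 0" by (rule bounded_forced_limit_zero[OF g H bddg bddw])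
  then have "L = \<kappa>" using standing_assms_equilibrium_unique[OF st \<open>0 < L\<close>] by simp
  then have lim\<kappa>: "(\<phi> \<longlongrightarrow> \<kappa>) at_top" using lim by simp
  have side: "\<sigma> * \<kappa> \<le> \<sigma> * \<phi> t" if "T \<le> t" for t
  proof (rule tendsto_upperbound)
    show "((\<lambda>t. \<sigma> * \<phi> t) \<longlongrightarrow> \<sigma> * \<kappa>) at_top" by (intro tendsto_intros lim\<kappa>)
    show "\<forall>\<^sub>F s in at_top. \<sigma> * \<phi> s \<le> \<sigma> * \<phi> t"
      using anti[OF that] unfolding eventually_at_top_linorder by blast
  qed simp
  show False
  proof (cases "\<exists>t\<ge>T. \<phi> t = \<kappa>")
    case True
    then obtain t where t: "T \<le> t" "\<phi> t = \<kappa>" by blast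
    have const: "\<phi> s = \<kappa>" if "t \<le> s" for s
    proof -
      have "\<sigma> * \<phi> s \<le> \<sigma> * \<kappa>" using anti[OF t(1) that] unfolding t(2) .
      moreover have "\<sigma> * \<kappa> \<le> \<sigma> * \<phi> s" using side t(1) that by simp
      ultimately show ?thesis using \<sigma> by auto
    qed
    show False
      by (rule wave_profile_not_eventually_const[OF cont at_bot \<kappa> h standing_assmsD(5)[OF st \<kappa>] _
            standing_assmsD(2)[OF st] H g const]) (use \<beta> in auto)
  next
    case False
    have strict: "\<sigma> * \<kappa> < \<sigma> * \<phi> t" if "T \<le> t" for t
    proof -
      have "\<sigma> * \<kappa> \<noteq> \<sigma> * \<phi> t" using False that \<sigma> by auto
      with side[OF that] show ?thesis by (rule order_neq_le_trans[rotated])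
    qed
    have m: "0 < m" using assms by simp
    obtain \<theta> where \<theta>: "0 < \<theta>" "\<And>x. 0 \<le> x \<Longrightarrow> D * m * \<kappa> powr (m - 1) * x\<^sup>2 + c * x
        \<le> (1 - \<theta>) * (d' \<kappa> + (- b' \<kappa>) * exp (x * (c * r)))"
      using characteristic_margin[OF \<beta> \<delta> \<kappa> assms(2) m assms(3) c speed] by blast
    show False
      by (rule no_strict_monotone_approach[OF assms(1,2) \<kappa> c h \<delta> \<beta> \<theta> standing_assmsD(5)[OF st \<kappa>]
            standing_assmsD(6)[OF st \<kappa>] standing_assmsD(2)[OF st] H g nonneg bddg lim\<kappa> \<sigma> strict anti])
  qed
qed

text \<open>The threshold is chosen before \<open>b\<close> and \<open>d\<close>, so it depends on
  them only through \<open>b' \<kappa>\<close> and \<open>d' \<kappa>\<close>. Since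
  \<open>real_of_ereal\<close> maps infinity to 0, finiteness for large \<open>r\<close> is stated
  separately.\<close>

theorem theorem2p5:
  fixes m D \<kappa> :: real
  assumes "1 < m" and "0 < D"
  shows "\<exists>C :: real \<Rightarrow> real \<Rightarrow> real \<Rightarrow> ereal.
    \<forall>b b' d d' d''. standing_assms \<kappa> b b' d d' d'' \<and> b' \<kappa> < 0 \<longrightarrow>
      (\<forall>r>0. 0 < C r (b' \<kappa>) (d' \<kappa>) \<and>
         (\<forall>c \<phi>. semi_wavefront D m r \<kappa> b d c \<phi> \<and> C r (b' \<kappa>) (d' \<kappa>) < ereal c
                 \<longrightarrow> \<not> eventually_monotone \<phi>)) \<and>
      eventually (\<lambda>r. C r (b' \<kappa>) (d' \<kappa>) < \<infinity>) at_top \<and>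
      ((\<lambda>r. r * real_of_ereal (C r (b' \<kappa>) (d' \<kappa>))) \<longlongrightarrow> mu_k D m \<kappa> (b' \<kappa>) (d' \<kappa>)) at_top"
proof (intro exI[of _ "c_kappa D m \<kappa>"] allI impI)
  fix b b' d d' d'' :: "real \<Rightarrow> real"
  assume "standing_assms \<kappa> b b' d d' d'' \<and> b' \<kappa> < 0"
  then have st: "standing_assms \<kappa> b b' d d' d''" and \<beta>: "b' \<kappa> < 0" by auto
  have m: "0 < m" using assms by simp
  note \<kappa> = standing_assmsD(1)[OF st]
  note asym = c_kappa_asymptotics[OF \<beta> standing_assmsD(7)[OF st \<kappa>] \<kappa> assms(2) m]
  show "(\<forall>r>0. 0 < c_kappa D m \<kappa> r (b' \<kappa>) (d' \<kappa>) \<and>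
         (\<forall>c \<phi>. semi_wavefront D m r \<kappa> b d c \<phi> \<and> c_kappa D m \<kappa> r (b' \<kappa>) (d' \<kappa>) < ereal c
                 \<longrightarrow> \<not> eventually_monotone \<phi>)) \<and>
      eventually (\<lambda>r. c_kappa D m \<kappa> r (b' \<kappa>) (d' \<kappa>) < \<infinity>) at_top \<and>
      ((\<lambda>r. r * real_of_ereal (c_kappa D m \<kappa> r (b' \<kappa>) (d' \<kappa>))) \<longlongrightarrow> mu_k D m \<kappa> (b' \<kappa>) (d' \<kappa>)) at_top"
    using asym fast_semi_wavefront_not_eventually_monotone[OF assms _ st \<beta>] by blast
qed

end
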